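(* Let $\Omega\subset\mathbb{R}^2$, $u_0$, $A$, and the classes and functionals be as in the context, and let $p>1$. Let $f(\xi)=f_1(\xi_1)+f_2(\xi_2)$, $\xi=(\xi_1,\xi_2)\in\mathbb{R}^2$, with convex $f_1,f_2\in C^2(\mathbb{R})$, $f_2(t)=A(|t|)$, satisfying, for all $t\in\mathbb{R}$, $$a_1|t|-a_2\le f_1(t)\le a_3|t|+a_4,\qquad c_1(1+|t|)^{-\mu}\le f_1''(t)\le\overline{c}_1(1+|t|)^{\gamma},$$ $$b_1|t|^p-b_2\le f_2(t)\le b_3|t|^p+b_4,\qquad c_2(1+|t|)^{p-2}\le f_2''(t)\le\overline{c}_2(1+|t|)^{p-2},$$ with some $\mu>1$, $\gamma\ge0$ and constants $a_2,a_4,b_2,b_4\ge0$, $a_1,a_3,b_1,b_3,c_1,\overline{c}_1,c_2,\overline{c}_2>0$. Suppose moreover that $u^*\in\mathcal{M}$ is an $L^1$-cluster point of a sequence $\{u_\delta\}$ from $u_0+W^{1,1}_0(\Omega)$ such that for some $\varkappa\in\mathbb{R}$ the functions $$h_\delta:=\big(1+|\partial_1u_\delta|^2\big)^{\frac{\varkappa}{2}}+\big(1+|\partial_2u_\delta|^2\big)^{\frac{\varkappa}{2}}$$ are of class $W^{1,1}_{\mathrm{loc}}(\Omega)$ uniformly with respect to $\delta\in(0,1)$. Then the dual problem $$R[\tau]\to\max\quad\text{in }L^{\infty,A^*}(\Omega;\mathbb{R}^2)$$ is uniquely solvable.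
   Context: $\Omega\subset\mathbb{R}^2$ is a bounded Lipschitz domain that is normal with respect to the $x_2$-axis: there are $a<b$ and Lipschitz functions $\kappa_1,\kappa_2:(a,b)\to\mathbb{R}$ with $\Omega=\{x\in\mathbb{R}^2: x_1\in(a,b),\ \kappa_1(x_1)<x_2<\kappa_2(x_1)\}$. The boundary datum satisfies $u_0\in W^{1,\infty}(\Omega)$. $A:[0,\infty)\to[0,\infty)$ is an $N$-function of class $C^1([0,\infty))$ satisfying: (N1) $A$ is continuous, strictly increasing and convex; (N2) $\lim_{t\downarrow0}A(t)/t=0$ and $\lim_{t\to\infty}A(t)/t=\infty$; (N3) there are $k,t_0>0$ with $A(2t)\le kA(t)$ for all $t\ge t_0$. With the conjugate function $A^*(s)=\max_{t\ge0}\{st-A(t)\}$, $s\ge0$, it is assumed that $A^*(A'(t))\le c[A(t)+1]$ for all $t\ge0$ with some constant $c$; also $A(|t+\hat t|)\le c_3[A(|t|)+A(|\hat t|)]$ for all $t,\hat t\in\mathbb{R}$ with some $c_3>0$. Further $f_1^*(s)=\sup_{t\in\mathbb{R}}\{st-f_1(t)\}$. For an $N$-function $B$, $L_B(\Omega)$ is the Orlicz space of measurable $u:\Omega\to\mathbb{R}$ with $\int_\Omega B(\lambda|u|)\,dx<\infty$ for some $\lambda>0$. $L^{\infty,A^*}(\Omega;\mathbb{R}^2):=L^\infty(\Omega)\times L_{A^*}(\Omega)$. $\mathcal{C}_{\mathrm{Sob}}=\{w\in W^{1,1}(\Omega):\ \partial_2w\in L_A(\Omega),\ w-u_0\in W^{1,1}_0(\Omega)\}$.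 $J[w]=\int_\Omega f(\nabla w)\,dx$, to be minimized in $\mathcal{C}_{\mathrm{Sob}}$; $\mathcal{M}$ is the set of all $u\in BV(\Omega)$ such that $u$ is the $L^1(\Omega)$-limit of a $J$-minimizing sequence from $u_0+W^{1,1}_0(\Omega)$. The Lagrangian is, for $v\in\mathcal{C}_{\mathrm{Sob}}$ and $\tau=(\tau_1,\tau_2)\in L^{\infty,A^*}(\Omega;\mathbb{R}^2)$, $$l(v,\tau)=\int_\Omega\tau\cdot\nabla v\,dx-\int_\Omega f_1^*(\tau_1)\,dx-\int_\Omega A^*(|\tau_2|)\,dx\in[-\infty,\infty),$$ and the dual functional is $R[\tau]=\inf_{w\in\mathcal{C}_{\mathrm{Sob}}}l(w,\tau)$. "Of class $W^{1,1}_{\mathrm{loc}}(\Omega)$ uniformly with respect to $\delta$" means that for every compact $\omega\subset\Omega$ the norms of $h_\delta$ in $W^{1,1}$ on $\omega$ are bounded independently of $\delta$. *)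

theory Defs
  imports "HOL-Analysis.Analysis"
begin

section \<open>Domains in the plane\<close>

(* Near every boundary point the set is, after a rotation or reflection of the coordinate
   axes (the orthonormal pair e1, e2), the strict epigraph of a Lipschitz function. *)
definition lipschitz_domain :: "(real^2) set \<Rightarrow> bool" where
  "lipschitz_domain \<Omega> \<longleftrightarrow> open \<Omega> \<and> connected \<Omega> \<and> \<Omega> \<noteq> {} \<and>
     (\<forall>z\<in>frontier \<Omega>. \<exists>(e1::real^2) (e2::real^2) r L (g::real \<Rightarrow> real).
        norm e1 = 1 \<and> norm e2 = 1 \<and> e1 \<bullet> e2 = 0 \<and> r > 0 \<and> L-lipschitz_on UNIV g \<and>
        (\<forall>y\<in>ball z r. y \<in> \<Omega> \<longleftrightarrow> g (y \<bullet> e1) < y \<bullet> e2))"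

(* Lipschitz continuity of \<kappa>1, \<kappa>2 does not by itself exclude cusps over the end points
   of (a,b), so this does not imply lipschitz_domain. *)
definition normal_domain_x2 :: "(real^2) set \<Rightarrow> bool" where
  "normal_domain_x2 \<Omega> \<longleftrightarrow>
     (\<exists>a b L1 L2 (\<kappa>1::real \<Rightarrow> real) (\<kappa>2::real \<Rightarrow> real).
        a < b \<and> L1-lipschitz_on {a<..<b} \<kappa>1 \<and> L2-lipschitz_on {a<..<b} \<kappa>2 \<and>
        \<Omega> = {x. a < x$1 \<and> x$1 < b \<and> \<kappa>1 (x$1) < x$2 \<and> x$2 < \<kappa>2 (x$1)})"


section \<open>Test functions\<close>

definition partial :: "2 \<Rightarrow> (real^2 \<Rightarrow> real) \<Rightarrow> real^2 \<Rightarrow> real" where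
  "partial i \<phi> x = frechet_derivative \<phi> (at x) (axis i 1)"

primrec Ck :: "nat \<Rightarrow> (real^2 \<Rightarrow> real) \<Rightarrow> bool" where
  "Ck 0 \<phi> \<longleftrightarrow> continuous_on UNIV \<phi>"
| "Ck (Suc k) \<phi> \<longleftrightarrow> \<phi> differentiable_on UNIV \<and> (\<forall>i. Ck k (partial i \<phi>))"

definition supported_in :: "(real^2) set \<Rightarrow> (real^2 \<Rightarrow> real) \<Rightarrow> bool" where
  "supported_in \<Omega> \<phi> \<longleftrightarrow> (\<exists>K. compact K \<and> K \<subseteq> \<Omega> \<and> (\<forall>x. x \<notin> K \<longrightarrow> \<phi> x = 0))"

definition test_functions :: "(real^2) set \<Rightarrow> (real^2 \<Rightarrow> real) set" where
  "test_functions \<Omega> = {\<phi>. (\<forall>k. Ck k \<phi>) \<and> supported_in \<Omega> \<phi>}"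


section \<open>Function spaces\<close>

(* Members of the function spaces are representatives real^2 \<Rightarrow> real; their values outside
   \<Omega> are irrelevant and almost everywhere equal functions are not identified. *)

definition locally_integrable :: "(real^2) set \<Rightarrow> (real^2 \<Rightarrow> real) \<Rightarrow> bool" where
  "locally_integrable \<Omega> u \<longleftrightarrow> (\<forall>K. compact K \<and> K \<subseteq> \<Omega> \<longrightarrow> set_integrable lebesgue K u)"

definition has_weak_partial ::
    "(real^2) set \<Rightarrow> 2 \<Rightarrow> (real^2 \<Rightarrow> real) \<Rightarrow> (real^2 \<Rightarrow> real) \<Rightarrow> bool" where
  "has_weak_partial \<Omega> i u g \<longleftrightarrow> locally_integrable \<Omega> u \<and> locally_integrable \<Omega> g \<and>
     (\<forall>\<phi>\<in>test_functions \<Omega>.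
        (LINT x|lebesgue_on \<Omega>. u x * partial i \<phi> x) = - (LINT x|lebesgue_on \<Omega>. g x * \<phi> x))"

definition W11_loc :: "(real^2) set \<Rightarrow> (real^2 \<Rightarrow> real) set" where
  "W11_loc \<Omega> = {u. \<forall>i. \<exists>g. has_weak_partial \<Omega> i u g}"

(* A representative of the weak partial derivative, which for open \<Omega> is determined
   almost everywhere in \<Omega>; meaningful only for u in W11_loc. *)
definition wpartial :: "(real^2) set \<Rightarrow> 2 \<Rightarrow> (real^2 \<Rightarrow> real) \<Rightarrow> real^2 \<Rightarrow> real" where
  "wpartial \<Omega> i u = (SOME g. has_weak_partial \<Omega> i u g)"

definition wgrad :: "(real^2) set \<Rightarrow> (real^2 \<Rightarrow> real) \<Rightarrow> real^2 \<Rightarrow> real^2" where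
  "wgrad \<Omega> u x = (\<chi> i. wpartial \<Omega> i u x)"

definition Linf :: "(real^2) set \<Rightarrow> (real^2 \<Rightarrow> real) set" where
  "Linf \<Omega> = {u \<in> borel_measurable (lebesgue_on \<Omega>). \<exists>C. AE x in lebesgue_on \<Omega>. \<bar>u x\<bar> \<le> C}"

definition W11 :: "(real^2) set \<Rightarrow> (real^2 \<Rightarrow> real) set" where
  "W11 \<Omega> = {u \<in> W11_loc \<Omega>. integrable (lebesgue_on \<Omega>) u \<and>
              (\<forall>i. integrable (lebesgue_on \<Omega>) (wpartial \<Omega> i u))}"

definition W1inf :: "(real^2) set \<Rightarrow> (real^2 \<Rightarrow> real) set" where
  "W1inf \<Omega> = {u \<in> W11_loc \<Omega>. u \<in> Linf \<Omega> \<and> (\<forall>i. wpartial \<Omega> i u \<in> Linf \<Omega>)}"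

definition L1_tendsto :: "(real^2) set \<Rightarrow> (nat \<Rightarrow> real^2 \<Rightarrow> real) \<Rightarrow> (real^2 \<Rightarrow> real) \<Rightarrow> bool" where
  "L1_tendsto \<Omega> w u \<longleftrightarrow> (\<forall>n. integrable (lebesgue_on \<Omega>) (w n)) \<and> integrable (lebesgue_on \<Omega>) u \<and>
     (\<lambda>n. LINT x|lebesgue_on \<Omega>. \<bar>w n x - u x\<bar>) \<longlonglongrightarrow> 0"

(* Closure of the test functions in the W11 norm. *)
definition W11_0 :: "(real^2) set \<Rightarrow> (real^2 \<Rightarrow> real) set" where
  "W11_0 \<Omega> = {w \<in> W11 \<Omega>. \<exists>\<phi>. (\<forall>n. \<phi> n \<in> test_functions \<Omega>) \<and> L1_tendsto \<Omega> \<phi> w \<and>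
                (\<forall>i. L1_tendsto \<Omega> (\<lambda>n. partial i (\<phi> n)) (wpartial \<Omega> i w))}"

(* The affine class u0 + W11_0. *)
definition W11_bdry :: "(real^2) set \<Rightarrow> (real^2 \<Rightarrow> real) \<Rightarrow> (real^2 \<Rightarrow> real) set" where
  "W11_bdry \<Omega> u0 = {w \<in> W11 \<Omega>. (\<lambda>x. w x - u0 x) \<in> W11_0 \<Omega>}"

definition BV :: "(real^2) set \<Rightarrow> (real^2 \<Rightarrow> real) set" where
  "BV \<Omega> = {u. integrable (lebesgue_on \<Omega>) u \<and>
     (\<exists>C. \<forall>\<phi> :: real^2 \<Rightarrow> real^2.
        (\<forall>i. Ck 1 (\<lambda>x. \<phi> x $ i) \<and> supported_in \<Omega> (\<lambda>x. \<phi> x $ i)) \<and> (\<forall>x. norm (\<phi> x) \<le> 1) \<longrightarrow>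
        (LINT x|lebesgue_on \<Omega>. u x * (\<Sum>i\<in>UNIV. partial i (\<lambda>y. \<phi> y $ i) x)) \<le> C)}"

definition Orlicz :: "(real \<Rightarrow> real) \<Rightarrow> (real^2) set \<Rightarrow> (real^2 \<Rightarrow> real) set" where
  "Orlicz B \<Omega> = {u \<in> borel_measurable (lebesgue_on \<Omega>).
     \<exists>r>0. (\<integral>\<^sup>+x. ennreal (B (r * \<bar>u x\<bar>)) \<partial>lebesgue_on \<Omega>) < \<infinity>}"

definition W11_loc_uniformly :: "(real^2) set \<Rightarrow> real set \<Rightarrow> (real \<Rightarrow> real^2 \<Rightarrow> real) \<Rightarrow> bool" where
  "W11_loc_uniformly \<Omega> D h \<longleftrightarrow> (\<forall>\<delta>\<in>D. h \<delta> \<in> W11_loc \<Omega>) \<and>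
     (\<forall>K. compact K \<and> K \<subseteq> \<Omega> \<longrightarrow>
        (\<exists>C. \<forall>\<delta>\<in>D. (LINT x|lebesgue_on K. \<bar>h \<delta> x\<bar>)
               + (\<Sum>i\<in>UNIV. LINT x|lebesgue_on K. \<bar>wpartial \<Omega> i (h \<delta>) x\<bar>) \<le> C))"


section \<open>Convex functions\<close>

(* A' is the derivative of A on [0,\<infinity>), one-sided at 0. *)
definition N_function_C1 :: "(real \<Rightarrow> real) \<Rightarrow> (real \<Rightarrow> real) \<Rightarrow> bool" where
  "N_function_C1 A A' \<longleftrightarrow>
     (\<forall>t\<ge>0. A t \<ge> 0) \<and>
     (\<forall>t\<ge>0. (A has_real_derivative A' t) (at t within {0..})) \<and> continuous_on {0..} A' \<and>
     continuous_on {0..} A \<and> strict_mono_on {0..} A \<and> convex_on {0..} A \<and>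
     ((\<lambda>t. A t / t) \<longlongrightarrow> 0) (at_right 0) \<and> filterlim (\<lambda>t. A t / t) at_top at_top \<and>
     (\<exists>k>0. \<exists>t0>0. \<forall>t\<ge>t0. A (2 * t) \<le> k * A t)"

(* For an N-function the supremum is attained, so the real-valued SUP is the maximum. *)
definition conj_N :: "(real \<Rightarrow> real) \<Rightarrow> real \<Rightarrow> real" where
  "conj_N A s = (SUP t\<in>{0..}. s * t - A t)"

definition conj_R :: "(real \<Rightarrow> real) \<Rightarrow> real \<Rightarrow> ereal" where
  "conj_R g s = (SUP t. ereal (s * t - g t))"

definition C2_real :: "(real \<Rightarrow> real) \<Rightarrow> bool" where
  "C2_real g \<longleftrightarrow> (\<forall>t. g differentiable at t) \<and> (\<forall>t. deriv g differentiable at t) \<and>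
     continuous_on UNIV (deriv (deriv g))"


section \<open>The variational problem and its dual\<close>

(* Lebesgue integral of the positive part minus that of the negative part; e2ennreal maps
   negative numbers to 0. All integrands below have a negative part of finite integral. *)
definition eintegral :: "'a measure \<Rightarrow> ('a \<Rightarrow> ereal) \<Rightarrow> ereal" where
  "eintegral M g = enn2ereal (\<integral>\<^sup>+x. e2ennreal (g x) \<partial>M) - enn2ereal (\<integral>\<^sup>+x. e2ennreal (- g x) \<partial>M)"

definition C_Sob :: "(real^2) set \<Rightarrow> (real \<Rightarrow> real) \<Rightarrow> (real^2 \<Rightarrow> real) \<Rightarrow> (real^2 \<Rightarrow> real) set" where
  "C_Sob \<Omega> A u0 = {w \<in> W11_bdry \<Omega> u0. wpartial \<Omega> 2 w \<in> Orlicz A \<Omega>}"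

definition J_fun :: "(real^2) set \<Rightarrow> (real^2 \<Rightarrow> real) \<Rightarrow> (real^2 \<Rightarrow> real) \<Rightarrow> ereal" where
  "J_fun \<Omega> f w = eintegral (lebesgue_on \<Omega>) (\<lambda>x. ereal (f (wgrad \<Omega> w x)))"

definition gen_minimizers ::
    "(real^2) set \<Rightarrow> (real \<Rightarrow> real) \<Rightarrow> (real^2 \<Rightarrow> real) \<Rightarrow> (real^2 \<Rightarrow> real) \<Rightarrow> (real^2 \<Rightarrow> real) set" where
  "gen_minimizers \<Omega> A u0 f = {u \<in> BV \<Omega>. \<exists>w. (\<forall>n. w n \<in> W11_bdry \<Omega> u0) \<and>
     (\<lambda>n. J_fun \<Omega> f (w n)) \<longlonglongrightarrow> (INF v\<in>C_Sob \<Omega> A u0. J_fun \<Omega> f v) \<and> L1_tendsto \<Omega> w u}"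

definition L_inf_Astar :: "(real^2) set \<Rightarrow> (real \<Rightarrow> real) \<Rightarrow> (real^2 \<Rightarrow> real^2) set" where
  "L_inf_Astar \<Omega> A =
     {\<tau>. (\<lambda>x. \<tau> x $ 1) \<in> Linf \<Omega> \<and> (\<lambda>x. \<tau> x $ 2) \<in> Orlicz (conj_N A) \<Omega>}"

definition lagrangian :: "(real^2) set \<Rightarrow> (real \<Rightarrow> real) \<Rightarrow> (real \<Rightarrow> real) \<Rightarrow>
    (real^2 \<Rightarrow> real) \<Rightarrow> (real^2 \<Rightarrow> real^2) \<Rightarrow> ereal" where
  "lagrangian \<Omega> A f1 v \<tau> =
     ereal (LINT x|lebesgue_on \<Omega>. \<tau> x \<bullet> wgrad \<Omega> v x)
     - eintegral (lebesgue_on \<Omega>) (\<lambda>x. conj_R f1 (\<tau> x $ 1))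
     - eintegral (lebesgue_on \<Omega>) (\<lambda>x. ereal (conj_N A \<bar>\<tau> x $ 2\<bar>))"

definition R_fun :: "(real^2) set \<Rightarrow> (real \<Rightarrow> real) \<Rightarrow> (real \<Rightarrow> real) \<Rightarrow>
    (real^2 \<Rightarrow> real) \<Rightarrow> (real^2 \<Rightarrow> real^2) \<Rightarrow> ereal" where
  "R_fun \<Omega> A f1 u0 \<tau> = (INF w\<in>C_Sob \<Omega> A u0. lagrangian \<Omega> A f1 w \<tau>)"

definition dual_solution :: "(real^2) set \<Rightarrow> (real \<Rightarrow> real) \<Rightarrow> (real \<Rightarrow> real) \<Rightarrow>
    (real^2 \<Rightarrow> real) \<Rightarrow> (real^2 \<Rightarrow> real^2) \<Rightarrow> bool" where
  "dual_solution \<Omega> A f1 u0 \<tau> \<longleftrightarrow> \<tau> \<in> L_inf_Astar \<Omega> A \<and>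
     (\<forall>\<sigma>\<in>L_inf_Astar \<Omega> A. R_fun \<Omega> A f1 u0 \<sigma> \<le> R_fun \<Omega> A f1 u0 \<tau>)"

end

theory Submission
  imports Defs
begin

text \<open>The Lagrangian is \<open>l(w, \<tau>) = \<integral> \<tau> \<bullet> \<nabla>w - G(\<tau>)\<close> with the conjugate energy
\<open>G(\<tau>) = \<integral> f\<^sub>1\<^sup>*(\<tau>\<^sub>1) + A\<^sup>*(\<bar>\<tau>\<^sub>2\<bar>)\<close>, and the dual functional \<open>R\<close> is its infimum over \<open>w\<close>. The first term is
linear in \<open>\<tau>\<close>, so \<open>R\<close> is concave, and any strict convexity of \<open>G\<close> is inherited uniformly in \<open>w\<close>.

The density splits, hence \<open>G\<close> is built from conjugates of functions of one real variable, \<open>f\<^sub>1\<close> and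
\<open>f\<^sub>2(t) = A(\<bar>t\<bar>)\<close>. The effective domain of such a conjugate is an interval, bounded in the case of linear
growth, and the open segment between any two of its points lies in the interior, where the conjugate
of a \<open>C\<^sup>1\<close> function is strictly convex. So strict convexity holds on the whole effective domain,
including its end points. The lemma \<open>conj_uniformly_convex\<close> gives this a quantitative form: \<open>\<bar>s - t\<bar>\<close> is
bounded by a constant times the defect in the midpoint inequality, up to a small multiple of the
conjugate values themselves.

Integration turns this into an \<open>L\<^sup>1\<close>-estimate for the distance of two dual fields. For two fields
whose values of \<open>R\<close> are within \<open>\<delta>\<close> of the supremum the defect of \<open>G\<close> is at most \<open>2 \<delta>\<close>, because their
midpoint does not exceed the supremum, and \<open>G\<close> is bounded on such fields by Young's inequality.
Therefore maximizers are unique, and a maximizing sequence is Cauchy in \<open>L\<^sup>1\<close>; a subsequence converges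
a.e. In the form \<open>l(w, \<tau>) = J[w] - \<integral> gap\<close>, with the nonnegative gap in the inequality of Fenchel and
Young, the lemma of Fatou shows that the limit is a maximizer (\<open>dual_problem_uniquely_solvable\<close>).

The Sobolev setting enters in two places. The growth conditions on \<open>f\<^sub>1\<close> and \<open>f\<^sub>2\<close> make the energies of
all multiples of a competitor's gradient finite (\<open>C_Sob_finite_modular\<close>). The class of competitors
contains \<open>u\<^sub>0\<close>; for this the zero function must belong to \<open>W\<^sup>1\<^sup>,\<^sup>1\<close> with zero trace, that is, the
chosen representative of its weak gradient must vanish a.e., which is the fundamental lemma of the
calculus of variations (\<open>fundamental_lemma_of_variations\<close>).\<close>

section \<open>Conjugates of functions of one real variable\<close>

text \<open>The conjugate of a function of linear growth is infinite outside a bounded interval. It is split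
into its effective domain and its real values there, so that integrals of it are ordinary real
integrals.\<close>
definition conj_dom :: "(real \<Rightarrow> real) \<Rightarrow> real set" where
  "conj_dom g = {s. conj_R g s \<noteq> \<infinity>}"

definition conj_val :: "(real \<Rightarrow> real) \<Rightarrow> real \<Rightarrow> real" where
  "conj_val g s = real_of_ereal (conj_R g s)"

lemma conj_R_upper: "ereal (s * t - g t) \<le> conj_R g s"
  unfolding conj_R_def by (rule SUP_upper) simp

lemma conj_R_not_MInf: "conj_R g s \<noteq> -\<infinity>"
  using conj_R_upper[of s 0 g] by auto

lemma conj_R_eq: "conj_R g s = (if s \<in> conj_dom g then ereal (conj_val g s) else \<infinity>)"
  using conj_R_not_MInf[of g s] by (cases "conj_R g s") (auto simp: conj_dom_def conj_val_def)

lemma fenchel_young: "s \<in> conj_dom g \<Longrightarrow> s * t - g t \<le> conj_val g s"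
  using conj_R_upper[of s t g] conj_R_eq[of g s] by auto

lemma conj_val_least:
  assumes "\<And>t. s * t - g t \<le> c"
  shows "s \<in> conj_dom g" "conj_val g s \<le> c"
proof -
  have le: "conj_R g s \<le> ereal c"
    unfolding conj_R_def by (rule SUP_least) (use assms in simp)
  show "s \<in> conj_dom g" using le by (auto simp: conj_dom_def)
  then show "conj_val g s \<le> c" using le conj_R_eq[of g s] by simp
qed

lemma conj_val_ge_0: "s \<in> conj_dom g \<Longrightarrow> - g 0 \<le> conj_val g s"
  using fenchel_young[of s g 0] by simp

lemma conj_val_near_maximizer:
  assumes "s \<in> conj_dom g" "0 < e"
  shows "\<exists>t. conj_val g s - e < s * t - g t"
proof (rule ccontr)
  assume "\<nexists>t. conj_val g s - e < s * t - g t"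
  then have "\<And>t. s * t - g t \<le> conj_val g s - e" by (meson not_le)
  from conj_val_least(2)[OF this] show False using assms by simp
qed

lemma conj_midpoint:
  assumes "s \<in> conj_dom g" "t \<in> conj_dom g"
  shows "(s + t) / 2 \<in> conj_dom g"
    and "conj_val g s + conj_val g t - 2 * conj_val g ((s + t) / 2) \<ge> 0"
proof -
  have *: "(s + t) / 2 * x - g x \<le> (conj_val g s + conj_val g t) / 2" for x
    using fenchel_young[OF assms(1), of x] fenchel_young[OF assms(2), of x]
    by (simp add: field_simps)
  show "(s + t) / 2 \<in> conj_dom g" using conj_val_least(1)[OF *] .
  show "conj_val g s + conj_val g t - 2 * conj_val g ((s + t) / 2) \<ge> 0"
    using conj_val_least(2)[OF *] by simp
qed

text \<open>As a supremum of affine functions the conjugate is lower semicontinuous: its superlevel sets are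
open, so it is Borel although the supremum runs over uncountably many functions.\<close>
lemma conj_R_measurable [measurable]: "conj_R g \<in> borel_measurable borel"
proof (rule borel_measurableI_greater)
  fix a :: ereal
  have "{s. a < conj_R g s} = (\<Union>t. {s. a < ereal (s * t - g t)})"
    by (auto simp: conj_R_def less_SUP_iff)
  moreover have "open {s. a < ereal (s * t - g t)}" for t
    by (intro open_Collect_less continuous_intros)
  ultimately show "{x \<in> space borel. a < conj_R g x} \<in> sets borel"
    by (simp add: open_UN)
qed

lemma conj_val_measurable [measurable]: "conj_val g \<in> borel_measurable borel"
  unfolding conj_val_def[abs_def] by measurable

lemma conj_dom_measurable [measurable]: "Measurable.pred borel (\<lambda>s. s \<in> conj_dom g)"
  unfolding conj_dom_def by simp

text \<open>Superlinearity in a form that does not distinguish bounded from unbounded effective domains: large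
values of the conjugate control the argument with an arbitrarily small factor \<open>1 / T\<close>.\<close>
lemma abs_le_conj_val:
  assumes "s \<in> conj_dom g" "0 \<le> T"
  shows "T * \<bar>s\<bar> \<le> conj_val g s + max (g T) (g (- T))"
  using fenchel_young[OF assms(1), of T] fenchel_young[OF assms(1), of "- T"]
  by (cases "s \<ge> 0") (auto simp: algebra_simps)

lemma second_difference_small:
  fixes g g' :: "real \<Rightarrow> real"
  assumes d: "\<And>x. (g has_real_derivative g' x) (at x)" and c: "continuous_on UNIV g'"
    and "0 < e"
  shows "\<exists>h. 0 < h \<and> h \<le> 1 \<and> (\<forall>x. \<bar>x\<bar> \<le> X \<longrightarrow> g (x + h) + g (x - h) - 2 * g x \<le> e * h)"
proof -
  have "uniformly_continuous_on {- X - 1..X + 1} g'"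
    by (rule compact_uniformly_continuous[OF continuous_on_subset[OF c]]) auto
  then obtain d0 where d0: "d0 > 0"
    and uc: "\<And>x y. x \<in> {- X - 1..X + 1} \<Longrightarrow> y \<in> {- X - 1..X + 1} \<Longrightarrow> dist y x < d0 \<Longrightarrow> dist (g' y) (g' x) < e"
    unfolding uniformly_continuous_on_def using \<open>0 < e\<close> by metis
  define h where "h = min 1 (d0 / 3)"
  have h: "0 < h" "h \<le> 1" "2 * h < d0" using d0 by (auto simp: h_def)
  have "g (x + h) + g (x - h) - 2 * g x \<le> e * h" if "\<bar>x\<bar> \<le> X" for x
  proof -
    obtain y where y: "x < y" "y < x + h" "g (x + h) - g x = (x + h - x) * g' y"
      using MVT2[of x "x + h" g g'] d h by auto
    obtain z where z: "x - h < z" "z < x" "g x - g (x - h) = (x - (x - h)) * g' z"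
      using MVT2[of "x - h" x g g'] d h by auto
    have "dist (g' y) (g' z) < e"
      using y z that h by (intro uc) (auto simp: dist_real_def)
    then have "h * (g' y - g' z) \<le> h * e"
      using h by (intro mult_left_mono) (auto simp: dist_real_def)
    then show ?thesis using y z by (simp add: algebra_simps)
  qed
  with h show ?thesis by blast
qed

text \<open>The core of the proof: a quantitative strict convexity of the conjugate that reaches up to the
boundary of its effective domain. Put \<open>m = (s + t) / 2\<close> and let \<open>x\<close> almost attain the supremum that
defines the conjugate at \<open>m\<close>. Testing the suprema at \<open>s\<close> and \<open>t\<close> with \<open>x + h\<close> and \<open>x - h\<close> gains
\<open>(s - t) h\<close> in the midpoint inequality and loses only the second difference of \<open>g\<close> at \<open>x\<close>, which
is \<open>o(h)\<close> because \<open>g\<close> is \<open>C\<^sup>1\<close>. The step \<open>h\<close> can be chosen uniformly as long as \<open>x\<close> stays in a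
compact set, and \<open>x\<close> is bounded if \<open>\<bar>s - t\<bar>\<close> is not small and the conjugate is not large at \<open>s\<close>
and \<open>t\<close>; in the two remaining cases the first summand on the right dominates.\<close>
lemma conj_uniformly_convex:
  fixes g g' :: "real \<Rightarrow> real"
  assumes d: "\<And>x. (g has_real_derivative g' x) (at x)" and c: "continuous_on UNIV g'"
    and e: "0 < e"
  shows "\<exists>C\<ge>0. \<forall>s\<in>conj_dom g. \<forall>t\<in>conj_dom g.
     \<bar>s - t\<bar> \<le> e * (1 + 2 * g 0 + conj_val g s + conj_val g t)
            + C * (conj_val g s + conj_val g t - 2 * conj_val g ((s + t) / 2))"
proof -
  define T where "T = 2 / e"
  define B where "B = max (g T) (g (- T))"
  define K where "K = \<bar>2 * B - 2 * g 0\<bar>"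
  define X where "X = 2 * (K + 1) / e"
  have T: "T > 0" using e by (simp add: T_def)
  have K: "K \<ge> 0" by (simp add: K_def)
  obtain h where h: "0 < h" "h \<le> 1"
    and h2: "\<And>x. \<bar>x\<bar> \<le> X \<Longrightarrow> g (x + h) + g (x - h) - 2 * g x \<le> e / 2 * h"
    using second_difference_small[OF d c, of "e / 2" X] e by auto
  define \<eta> where "\<eta> = h * e / 4"
  have eta: "\<eta> > 0" using h e by (simp add: \<eta>_def)
  define C where "C = e * K / \<eta>"
  have C: "C \<ge> 0" using e K eta by (simp add: C_def)
  have main: "s - t \<le> e * (1 + 2 * g 0 + conj_val g s + conj_val g t)
            + C * (conj_val g s + conj_val g t - 2 * conj_val g ((s + t) / 2))"
    if s: "s \<in> conj_dom g" and t: "t \<in> conj_dom g" for s t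
  proof -
    \<comment> \<open>The Young inequality with argument 0 gives \<open>- g 0\<close> as a lower bound of the conjugate, so \<open>Q \<ge> 0\<close>.\<close>
    define Q where "Q = 2 * g 0 + conj_val g s + conj_val g t"
    define m where "m = (s + t) / 2"
    define D where "D = conj_val g s + conj_val g t - 2 * conj_val g m"
    have m: "m \<in> conj_dom g" and D0: "D \<ge> 0"
      using conj_midpoint[OF s t] by (auto simp: m_def D_def)
    have s0: "conj_val g s + g 0 \<ge> 0" and t0: "conj_val g t + g 0 \<ge> 0" and m0: "conj_val g m + g 0 \<ge> 0"
      using conj_val_ge_0[OF s] conj_val_ge_0[OF t] conj_val_ge_0[OF m] by auto
    have Q0: "Q \<ge> 0" using s0 t0 by (simp add: Q_def)
    have "T * (s - t) \<le> T * \<bar>s\<bar> + T * \<bar>t\<bar>"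
      using T by (metis abs_ge_self abs_triangle_ineq4 distrib_left mult_left_mono order_less_imp_le order_trans)
    also have "\<dots> \<le> Q + (2 * B - 2 * g 0)"
      using abs_le_conj_val[OF s, of T] abs_le_conj_val[OF t, of T] T by (simp add: Q_def B_def)
    also have "\<dots> \<le> Q + K" by (simp add: K_def)
    finally have st: "s - t \<le> e / 2 * (Q + K)"
      using e by (simp add: T_def field_simps)
    have "s - t \<le> e * (1 + Q) + C * D"
    proof (cases "Q \<ge> K \<or> s - t \<le> e")
      case True
      have "s - t \<le> e * (1 + Q)"
      proof (cases "Q \<ge> K")
        case True
        then have "e / 2 * (Q + K) \<le> e / 2 * (2 * (1 + Q))"
          using e by (intro mult_left_mono) auto
        moreover have "e / 2 * (2 * (1 + Q)) = e * (1 + Q)" by simp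
        ultimately show ?thesis using st by linarith
      next
        case False
        then have "s - t \<le> e" using True by auto
        moreover have "0 \<le> e * Q" using e Q0 by simp
        ultimately show ?thesis by (simp add: algebra_simps)
      qed
      moreover have "0 \<le> C * D" using C D0 by simp
      ultimately show ?thesis by linarith
    next
      case False
      then have QK: "Q < K" and ste: "s - t > e" by auto
      define \<theta> where "\<theta> = min 1 (\<eta> / 2)"
      have th: "\<theta> > 0" "\<theta> \<le> 1" "2 * \<theta> \<le> \<eta>" using eta by (auto simp: \<theta>_def)
      obtain x where x: "conj_val g m - \<theta> < m * x - g x"
        using conj_val_near_maximizer[OF m th(1)] by blast
      \<comment> \<open>Both ends of the segment have distance more than \<open>e / 2\<close> from \<open>m\<close> and conjugate values
        plus \<open>g 0\<close> bounded by \<open>K\<close>; this bounds the near-maximizer \<open>x\<close> from both sides.\<close>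
      have "(s - m) * x \<le> K + 1"
        using fenchel_young[OF s, of x] x th QK t0 m0 by (simp add: Q_def algebra_simps)
      moreover have "s - m = (s - t) / 2" by (simp add: m_def field_simps)
      ultimately have xu: "(s - t) / 2 * x \<le> K + 1" by simp
      have "(m - t) * (- x) \<le> K + 1"
        using fenchel_young[OF t, of x] x th QK s0 m0 by (simp add: Q_def algebra_simps)
      moreover have "m - t = (s - t) / 2" by (simp add: m_def field_simps)
      ultimately have xl: "(s - t) / 2 * (- x) \<le> K + 1" by simp
      have "(s - t) / 2 * \<bar>x\<bar> \<le> K + 1" using xu xl by (cases "x \<ge> 0") auto
      moreover have "e / 2 * \<bar>x\<bar> \<le> (s - t) / 2 * \<bar>x\<bar>"
        using ste by (intro mult_right_mono) auto
      ultimately have "\<bar>x\<bar> \<le> X" using e by (simp add: X_def field_simps)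
      from h2[OF this] have f2: "g (x + h) + g (x - h) - 2 * g x \<le> e / 2 * h" .
      have "s * (x + h) - g (x + h) \<le> conj_val g s" "t * (x - h) - g (x - h) \<le> conj_val g t"
        using fenchel_young s t by auto
      then have "conj_val g s + conj_val g t \<ge> (s + t) * x + (s - t) * h - (g (x + h) + g (x - h))"
        by (simp add: algebra_simps)
      moreover have "(s + t) * x = 2 * (m * x)" by (simp add: m_def)
      moreover have "e * h \<le> (s - t) * h" using ste h by (intro mult_right_mono) auto
      ultimately have "D \<ge> e * h / 2 - 2 * \<theta>"
        using f2 x by (simp add: D_def)
      then have "D \<ge> e * h / 2 - \<eta>" using th by linarith
      moreover have "e * h / 2 = 2 * \<eta>" by (simp add: \<eta>_def)
      ultimately have "D \<ge> \<eta>" by linarith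
      then have "C * \<eta> \<le> C * D" using C by (intro mult_left_mono) auto
      moreover have "C * \<eta> = e * K" using eta by (simp add: C_def)
      moreover have "e / 2 * (Q + K) \<le> e / 2 * (2 * K)"
        using e QK by (intro mult_left_mono) auto
      moreover have "0 \<le> e * (1 + Q)" using e Q0 by simp
      ultimately show ?thesis using st by simp
    qed
    then show ?thesis by (simp add: Q_def D_def m_def algebra_simps)
  qed
  have "\<bar>s - t\<bar> \<le> e * (1 + 2 * g 0 + conj_val g s + conj_val g t)
            + C * (conj_val g s + conj_val g t - 2 * conj_val g ((s + t) / 2))"
    if s: "s \<in> conj_dom g" and t: "t \<in> conj_dom g" for s t
    using main[OF s t] main[OF t s] by (auto simp: abs_le_iff add.commute add.left_commute)
  with C show ?thesis by blast
qed

text \<open>The defect in the inequality of Fenchel and Young. Since \<open>t = v\<close> is admitted, the supremum is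
nonnegative even before truncation by \<open>ennreal\<close>, and it is a supremum of functions that are
continuous in \<open>s\<close>; both properties are what the lemma of Fatou asks for.\<close>
definition fenchel_gap :: "(real \<Rightarrow> real) \<Rightarrow> real \<Rightarrow> real \<Rightarrow> ennreal" where
  "fenchel_gap g v s = (SUP t. ennreal ((s * t - g t) - (s * v - g v)))"

lemma fenchel_gap_finite:
  assumes "fenchel_gap g v s \<noteq> \<infinity>"
  shows "s \<in> conj_dom g" "ennreal (conj_val g s - (s * v - g v)) \<le> fenchel_gap g v s"
proof -
  obtain r where r: "fenchel_gap g v s = ennreal r" "r \<ge> 0"
    using assms by (cases "fenchel_gap g v s") auto
  have le: "ennreal ((s * t - g t) - (s * v - g v)) \<le> ennreal r" for t
    unfolding r(1)[symmetric] fenchel_gap_def by (rule SUP_upper) simp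
  then have *: "s * t - g t \<le> r + (s * v - g v)" for t
    proof -
    have "(s * t - g t) - (s * v - g v) \<le> r"
      using le[of t] r(2) by (simp add: ennreal_le_iff)
    then show ?thesis by linarith
  qed
  show "s \<in> conj_dom g" by (rule conj_val_least(1)[OF *])
  show "ennreal (conj_val g s - (s * v - g v)) \<le> fenchel_gap g v s"
    using conj_val_least(2)[OF *] unfolding r(1) by (intro ennreal_leI) simp
qed

lemma fenchel_gap_dom:
  assumes "s \<in> conj_dom g"
  shows "fenchel_gap g v s = ennreal (conj_val g s - (s * v - g v))"
proof (rule antisym)
  show le: "fenchel_gap g v s \<le> ennreal (conj_val g s - (s * v - g v))"
    unfolding fenchel_gap_def
    by (intro SUP_least ennreal_leI) (use fenchel_young[OF assms] in simp)
  then have "fenchel_gap g v s \<noteq> \<infinity>" by (auto simp: top_unique)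
  then show "ennreal (conj_val g s - (s * v - g v)) \<le> fenchel_gap g v s"
    by (rule fenchel_gap_finite(2))
qed

lemma fenchel_gap_eq:
  "fenchel_gap g v s = (if s \<in> conj_dom g then ennreal (conj_val g s - (s * v - g v)) else \<infinity>)"
  using fenchel_gap_dom[of s g v] fenchel_gap_finite(1)[of g v s] by (auto simp: infinity_ennreal_def)

lemma fenchel_gap_lsc:
  assumes "S \<longlonglongrightarrow> s"
  shows "fenchel_gap g v s \<le> liminf (\<lambda>n. fenchel_gap g v (S n))"
  unfolding fenchel_gap_def[of g v s]
proof (rule SUP_least)
  fix t
  have "(\<lambda>n. ennreal ((S n * t - g t) - (S n * v - g v))) \<longlonglongrightarrow> ennreal ((s * t - g t) - (s * v - g v))"
    by (intro tendsto_intros assms)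
  then have "ennreal ((s * t - g t) - (s * v - g v)) = liminf (\<lambda>n. ennreal ((S n * t - g t) - (S n * v - g v)))"
    by (simp add: lim_imp_Liminf)
  also have "\<dots> \<le> liminf (\<lambda>n. fenchel_gap g v (S n))"
    by (intro Liminf_mono always_eventually allI) (auto simp: fenchel_gap_def intro: SUP_upper)
  finally show "ennreal ((s * t - g t) - (s * v - g v)) \<le> liminf (\<lambda>n. fenchel_gap g v (S n))" .
qed

lemma N_function_conj_dom:
  assumes A: "N_function_C1 A A'" and g: "\<And>t. g t = A \<bar>t\<bar>"
  shows "s \<in> conj_dom g"
proof -
  have "\<forall>\<^sub>F t in at_top. \<bar>s\<bar> \<le> A t / t"
    using A by (auto simp: N_function_C1_def filterlim_at_top)
  then obtain T where T: "\<And>t. t \<ge> T \<Longrightarrow> \<bar>s\<bar> \<le> A t / t"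
    by (auto simp: eventually_at_top_linorder)
  define T' where "T' = max 1 T"
  have A0: "A t \<ge> 0" if "t \<ge> 0" for t using A that by (auto simp: N_function_C1_def)
  show ?thesis
  proof (rule conj_val_least(1))
    fix t
    have st: "s * t \<le> \<bar>s\<bar> * \<bar>t\<bar>" by (metis abs_ge_self abs_mult)
    show "s * t - g t \<le> \<bar>s\<bar> * T'"
    proof (cases "\<bar>t\<bar> \<ge> T'")
      case True
      then have "\<bar>t\<bar> > 0" "\<bar>t\<bar> \<ge> T" by (auto simp: T'_def)
      then have "\<bar>s\<bar> * \<bar>t\<bar> \<le> A \<bar>t\<bar>" using T[of "\<bar>t\<bar>"] by (simp only: pos_le_divide_eq)
      moreover have "0 \<le> \<bar>s\<bar> * T'" by (simp add: T'_def)
      ultimately show ?thesis using st by (simp add: g)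
    next
      case False
      then have "\<bar>s\<bar> * \<bar>t\<bar> \<le> \<bar>s\<bar> * T'" by (intro mult_left_mono) auto
      then show ?thesis using st A0[of "\<bar>t\<bar>"] by (simp add: g)
    qed
  qed
qed

lemma conj_N_eq_conj_val:
  assumes A: "N_function_C1 A A'" and g: "\<And>t. g t = A \<bar>t\<bar>"
  shows "conj_N A \<bar>s\<bar> = conj_val g s"
proof -
  have dom: "s \<in> conj_dom g" by (rule N_function_conj_dom[OF A g])
  have le: "\<bar>s\<bar> * t - A t \<le> conj_val g s" if "t \<ge> 0" for t
    using fenchel_young[OF dom, of "if s \<ge> 0 then t else - t"] that by (auto simp: g split: if_splits)
  then have bdd: "bdd_above ((\<lambda>t. \<bar>s\<bar> * t - A t) ` {0..})"
    by (auto intro!: bdd_aboveI)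
  show ?thesis
  proof (rule antisym)
    show "conj_N A \<bar>s\<bar> \<le> conj_val g s"
      unfolding conj_N_def by (rule cSUP_least) (use le in auto)
    show "conj_val g s \<le> conj_N A \<bar>s\<bar>"
    proof (rule conj_val_least(2))
      fix t
      have "s * t - g t \<le> \<bar>s\<bar> * \<bar>t\<bar> - A \<bar>t\<bar>"
        using abs_ge_self[of "s * t"] by (simp add: g abs_mult)
      also have "\<dots> \<le> conj_N A \<bar>s\<bar>"
        unfolding conj_N_def by (rule cSUP_upper[OF _ bdd]) simp
      finally show "s * t - g t \<le> conj_N A \<bar>s\<bar>" .
    qed
  qed
qed

lemma conj_dom_linear_growth:
  assumes growth: "\<And>t. g t \<le> a * \<bar>t\<bar> + b" and s: "s \<in> conj_dom g"
  shows "\<bar>s\<bar> \<le> a"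
proof (rule ccontr)
  assume "\<not> \<bar>s\<bar> \<le> a"
  then have d: "\<bar>s\<bar> - a > 0" by simp
  define t where "t = (\<bar>conj_val g s\<bar> + \<bar>b\<bar> + 1) / (\<bar>s\<bar> - a)"
  have t: "t > 0" unfolding t_def using d by (intro divide_pos_pos) auto
  define t' where "t' = (if s \<ge> 0 then t else - t)"
  have "s * t' = \<bar>s\<bar> * t" "\<bar>t'\<bar> = t" using t by (auto simp: t'_def)
  then have "\<bar>s\<bar> * t - (a * t + b) \<le> conj_val g s"
    using fenchel_young[OF s, of t'] growth[of t'] by simp
  moreover have "(\<bar>s\<bar> - a) * t = \<bar>conj_val g s\<bar> + \<bar>b\<bar> + 1" using d by (simp add: t_def)
  ultimately show False by (simp add: algebra_simps)
qed

section \<open>The dual problem for a separable integrand\<close>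

text \<open>Finiteness for every multiple is what membership in an Orlicz space amounts to under a doubling
condition. The multiples 1 and -1 make the pairing with a dual field integrable, and the multiple 2
bounds the conjugate energy of maximizing sequences.\<close>
definition finite_modular :: "'a measure \<Rightarrow> ('n \<Rightarrow> real \<Rightarrow> real) \<Rightarrow> ('a \<Rightarrow> real^'n) \<Rightarrow> bool" where
  "finite_modular M f v \<longleftrightarrow> (\<forall>i. (\<lambda>x. v x $ i) \<in> borel_measurable M \<and>
     (\<forall>c. integrable M (\<lambda>x. f i (c * v x $ i))))"

definition dual_admissible :: "'a measure \<Rightarrow> ('n \<Rightarrow> real \<Rightarrow> real) \<Rightarrow> ('a \<Rightarrow> real^'n) \<Rightarrow> bool" where
  "dual_admissible M f \<tau> \<longleftrightarrow> (\<forall>i. (\<lambda>x. \<tau> x $ i) \<in> borel_measurable M \<and>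
     (AE x in M. \<tau> x $ i \<in> conj_dom (f i)) \<and> integrable M (\<lambda>x. conj_val (f i) (\<tau> x $ i)))"

definition conj_energy ::
    "'a measure \<Rightarrow> ('n::finite \<Rightarrow> real \<Rightarrow> real) \<Rightarrow> ('a \<Rightarrow> real^'n) \<Rightarrow> real" where
  "conj_energy M f \<tau> = (\<Sum>i\<in>UNIV. LINT x|M. conj_val (f i) (\<tau> x $ i))"

definition sep_lagrangian ::
    "'a measure \<Rightarrow> ('n::finite \<Rightarrow> real \<Rightarrow> real) \<Rightarrow> ('a \<Rightarrow> real^'n) \<Rightarrow> ('a \<Rightarrow> real^'n) \<Rightarrow> real" where
  "sep_lagrangian M f v \<tau> = (LINT x|M. \<tau> x \<bullet> v x) - conj_energy M f \<tau>"

lemma finite_modularD: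
  assumes "finite_modular M f v"
  shows "(\<lambda>x. v x $ i) \<in> borel_measurable M" "integrable M (\<lambda>x. f i (c * v x $ i))"
    "integrable M (\<lambda>x. f i (v x $ i))" "integrable M (\<lambda>x. f i (- v x $ i))"
proof -
  show 1: "(\<lambda>x. v x $ i) \<in> borel_measurable M" "\<And>c. integrable M (\<lambda>x. f i (c * v x $ i))"
    using assms by (auto simp: finite_modular_def)
  show "integrable M (\<lambda>x. f i (v x $ i))" using 1(2)[of 1] by simp
  show "integrable M (\<lambda>x. f i (- v x $ i))" using 1(2)[of "- 1"] by simp
qed

lemma dual_admissibleD:
  assumes "dual_admissible M f \<tau>"
  shows "(\<lambda>x. \<tau> x $ i) \<in> borel_measurable M" "AE x in M. \<tau> x $ i \<in> conj_dom (f i)"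
    "integrable M (\<lambda>x. conj_val (f i) (\<tau> x $ i))"
  using assms by (auto simp: dual_admissible_def)

lemma dual_pairing_integrable:
  assumes \<tau>: "dual_admissible M f \<tau>" and v: "finite_modular M f v"
  shows "integrable M (\<lambda>x. \<tau> x $ i * v x $ i)"
proof (rule Bochner_Integration.integrable_bound)
  show "integrable M (\<lambda>x. conj_val (f i) (\<tau> x $ i) + \<bar>f i (v x $ i)\<bar> + \<bar>f i (- v x $ i)\<bar>)"
    using dual_admissibleD[OF \<tau>] finite_modularD[OF v] by auto
  show "(\<lambda>x. \<tau> x $ i * v x $ i) \<in> borel_measurable M"
    using dual_admissibleD(1)[OF \<tau>] finite_modularD(1)[OF v] by measurable
  show "AE x in M. norm (\<tau> x $ i * v x $ i)
      \<le> norm (conj_val (f i) (\<tau> x $ i) + \<bar>f i (v x $ i)\<bar> + \<bar>f i (- v x $ i)\<bar>)"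
    using dual_admissibleD(2)[OF \<tau>, of i]
  proof eventually_elim
    case (elim x)
    then show ?case
      using fenchel_young[OF elim, of "v x $ i"] fenchel_young[OF elim, of "- v x $ i"]
      by (auto simp: abs_if)
  qed
qed

lemma dual_inner_integral:
  fixes \<tau> v :: "'a \<Rightarrow> real^'n"
  assumes \<tau>: "dual_admissible M f \<tau>" and v: "finite_modular M f v"
  shows "integrable M (\<lambda>x. \<tau> x \<bullet> v x)"
    "(LINT x|M. \<tau> x \<bullet> v x) = (\<Sum>i\<in>UNIV. LINT x|M. \<tau> x $ i * v x $ i)"
  unfolding inner_vec_def inner_real_def using dual_pairing_integrable[OF \<tau> v]
  by (auto intro!: Bochner_Integration.integral_sum)

locale separable_dual = finite_measure M
  for M :: "'a measure" and f f' :: "'n::finite \<Rightarrow> real \<Rightarrow> real" +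
  assumes f_deriv: "\<And>i t. (f i has_real_derivative f' i t) (at t)"
    and f'_cont: "\<And>i. continuous_on UNIV (f' i)"
    and f_lower: "\<And>i. \<exists>B. \<forall>t. B \<le> f i t"
begin

abbreviation "adm \<equiv> dual_admissible M f"
abbreviation "E \<equiv> conj_energy M f"
abbreviation "L \<equiv> sep_lagrangian M f"
abbreviation "mid \<sigma> \<tau> \<equiv> (\<lambda>x. (1 / 2) *\<^sub>R (\<sigma> x + \<tau> x))"

lemma admissible_integrable:
  assumes \<tau>: "adm \<tau>"
  shows "integrable M (\<lambda>x. \<tau> x $ i)"
proof (rule Bochner_Integration.integrable_bound)
  show "integrable M (\<lambda>x. conj_val (f i) (\<tau> x $ i) + max (f i 1) (f i (- 1)))"
    using dual_admissibleD[OF \<tau>] by auto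
  show "(\<lambda>x. \<tau> x $ i) \<in> borel_measurable M"
    using dual_admissibleD[OF \<tau>] by auto
  show "AE x in M. norm (\<tau> x $ i) \<le> norm (conj_val (f i) (\<tau> x $ i) + max (f i 1) (f i (- 1)))"
    using dual_admissibleD(2)[OF \<tau>, of i]
    by eventually_elim (use abs_le_conj_val[of _ "f i" 1] in force)
qed

lemma admissible_vec_integrable:
  assumes \<tau>: "adm \<tau>"
  shows "integrable M \<tau>"
proof -
  have eq: "\<tau> = (\<lambda>x. \<Sum>i\<in>UNIV. (\<tau> x $ i) *\<^sub>R axis i 1)"
    by (simp add: fun_eq_iff vec_eq_iff axis_def if_distrib cong: if_cong)
  show ?thesis
    by (subst eq) (intro Bochner_Integration.integrable_sum integrable_scaleR_left admissible_integrable[OF \<tau>])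
qed

lemma midpoint_admissible:
  assumes \<sigma>: "adm \<sigma>" and \<tau>: "adm \<tau>"
  shows "adm (mid \<sigma> \<tau>)"
  unfolding dual_admissible_def
proof (intro allI conjI)
  fix i
  have eq: "mid \<sigma> \<tau> x $ i = (\<sigma> x $ i + \<tau> x $ i) / 2" for x by simp
  have m [measurable]: "(\<lambda>x. \<sigma> x $ i) \<in> borel_measurable M" "(\<lambda>x. \<tau> x $ i) \<in> borel_measurable M"
    using dual_admissibleD[OF \<sigma>] dual_admissibleD[OF \<tau>] by auto
  show "(\<lambda>x. mid \<sigma> \<tau> x $ i) \<in> borel_measurable M"
    unfolding eq by measurable
  show dom: "AE x in M. mid \<sigma> \<tau> x $ i \<in> conj_dom (f i)"
    unfolding eq using dual_admissibleD(2)[OF \<sigma>, of i] dual_admissibleD(2)[OF \<tau>, of i]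
    by eventually_elim (rule conj_midpoint)
  show "integrable M (\<lambda>x. conj_val (f i) (mid \<sigma> \<tau> x $ i))"
    unfolding eq
  proof (rule Bochner_Integration.integrable_bound)
    show "integrable M (\<lambda>x. \<bar>conj_val (f i) (\<sigma> x $ i)\<bar> + \<bar>conj_val (f i) (\<tau> x $ i)\<bar> + \<bar>f i 0\<bar>)"
      using dual_admissibleD(3)[OF \<sigma>, of i] dual_admissibleD(3)[OF \<tau>, of i] by simp
    show "(\<lambda>x. conj_val (f i) ((\<sigma> x $ i + \<tau> x $ i) / 2)) \<in> borel_measurable M"
      by measurable
    show "AE x in M. norm (conj_val (f i) ((\<sigma> x $ i + \<tau> x $ i) / 2))
        \<le> norm (\<bar>conj_val (f i) (\<sigma> x $ i)\<bar> + \<bar>conj_val (f i) (\<tau> x $ i)\<bar> + \<bar>f i 0\<bar>)"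
      using dual_admissibleD(2)[OF \<sigma>, of i] dual_admissibleD(2)[OF \<tau>, of i]
    proof eventually_elim
      case (elim x)
      show ?case
        using conj_midpoint[OF elim] conj_val_ge_0[OF conj_midpoint(1)[OF elim]] by auto
    qed
  qed
qed

text \<open>The pairing is linear in the dual field, so the Lagrangian gains at a midpoint exactly half the
convexity defect of the energy, the same amount for every \<open>v\<close>.\<close>
lemma lagrangian_midpoint:
  assumes \<sigma>: "adm \<sigma>" and \<tau>: "adm \<tau>" and v: "finite_modular M f v"
  shows "L v (mid \<sigma> \<tau>) = (L v \<sigma> + L v \<tau>) / 2 + (E \<sigma> + E \<tau> - 2 * E (mid \<sigma> \<tau>)) / 2"
proof -
  have "(LINT x|M. mid \<sigma> \<tau> x \<bullet> v x) = (LINT x|M. (1 / 2) * (\<sigma> x \<bullet> v x) + (1 / 2) * (\<tau> x \<bullet> v x))"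
    by (simp add: inner_add_left distrib_left)
  also have "\<dots> = ((LINT x|M. \<sigma> x \<bullet> v x) + (LINT x|M. \<tau> x \<bullet> v x)) / 2"
    using dual_inner_integral(1)[OF \<sigma> v] dual_inner_integral(1)[OF \<tau> v] by simp
  finally show ?thesis by (simp add: sep_lagrangian_def field_simps)
qed

text \<open>The uniform convexity of the conjugates, integrated. One constant serves all components because the
midpoint defects are nonnegative.\<close>
lemma L1_distance_estimate:
  assumes e: "0 < e"
  shows "\<exists>C\<ge>0. \<forall>\<sigma> \<tau>. adm \<sigma> \<longrightarrow> adm \<tau> \<longrightarrow>
    (LINT x|M. norm (\<sigma> x - \<tau> x)) \<le>
      e * ((\<Sum>i\<in>UNIV. (1 + 2 * f i 0) * measure M (space M)) + E \<sigma> + E \<tau>)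
      + C * (E \<sigma> + E \<tau> - 2 * E (mid \<sigma> \<tau>))"
proof -
  define D where "D i s t = conj_val (f i) s + conj_val (f i) t - 2 * conj_val (f i) ((s + t) / 2)" for i s t
  have "\<exists>C\<ge>0. \<forall>s\<in>conj_dom (f i). \<forall>t\<in>conj_dom (f i).
     \<bar>s - t\<bar> \<le> e * (1 + 2 * f i 0 + conj_val (f i) s + conj_val (f i) t) + C * D i s t" for i
    unfolding D_def by (rule conj_uniformly_convex[OF f_deriv f'_cont e])
  then obtain C where C: "\<And>i. C i \<ge> 0" and C_est: "\<And>i s t. s \<in> conj_dom (f i) \<Longrightarrow> t \<in> conj_dom (f i) \<Longrightarrow>
     \<bar>s - t\<bar> \<le> e * (1 + 2 * f i 0 + conj_val (f i) s + conj_val (f i) t) + C i * D i s t"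
    by metis
  define C0 where "C0 = (\<Sum>i\<in>UNIV. C i)"
  have C0: "C i \<le> C0" for i unfolding C0_def by (rule member_le_sum) (use C in auto)
  have C00: "C0 \<ge> 0" unfolding C0_def by (intro sum_nonneg C)
  have "(LINT x|M. norm (\<sigma> x - \<tau> x)) \<le>
      e * ((\<Sum>i\<in>UNIV. (1 + 2 * f i 0) * measure M (space M)) + E \<sigma> + E \<tau>)
      + C0 * (E \<sigma> + E \<tau> - 2 * E (mid \<sigma> \<tau>))" if \<sigma>: "adm \<sigma>" and \<tau>: "adm \<tau>" for \<sigma> \<tau>
  proof -
    note i\<sigma> = dual_admissibleD(3)[OF \<sigma>] and i\<tau> = dual_admissibleD(3)[OF \<tau>]
    have im: "integrable M (\<lambda>x. conj_val (f i) ((\<sigma> x $ i + \<tau> x $ i) / 2))" for i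
      using dual_admissibleD(3)[OF midpoint_admissible[OF \<sigma> \<tau>], of i] by simp
    have iD: "integrable M (\<lambda>x. D i (\<sigma> x $ i) (\<tau> x $ i))" for i
      unfolding D_def using i\<sigma> i\<tau> im by auto
    have comp: "(LINT x|M. \<bar>\<sigma> x $ i - \<tau> x $ i\<bar>) \<le>
        e * ((1 + 2 * f i 0) * measure M (space M) + (LINT x|M. conj_val (f i) (\<sigma> x $ i))
           + (LINT x|M. conj_val (f i) (\<tau> x $ i))) + C0 * (LINT x|M. D i (\<sigma> x $ i) (\<tau> x $ i))" for i
    proof -
      have "(LINT x|M. \<bar>\<sigma> x $ i - \<tau> x $ i\<bar>) \<le> (LINT x|M. e * ((1 + 2 * f i 0) + conj_val (f i) (\<sigma> x $ i)
         + conj_val (f i) (\<tau> x $ i)) + C0 * D i (\<sigma> x $ i) (\<tau> x $ i))"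
      proof (rule integral_mono_AE)
        show "integrable M (\<lambda>x. \<bar>\<sigma> x $ i - \<tau> x $ i\<bar>)"
          using admissible_integrable[OF \<sigma>] admissible_integrable[OF \<tau>] by auto
        show "integrable M (\<lambda>x. e * ((1 + 2 * f i 0) + conj_val (f i) (\<sigma> x $ i)
         + conj_val (f i) (\<tau> x $ i)) + C0 * D i (\<sigma> x $ i) (\<tau> x $ i))"
          using i\<sigma> i\<tau> iD by auto
        show "AE x in M. \<bar>\<sigma> x $ i - \<tau> x $ i\<bar> \<le> e * ((1 + 2 * f i 0) + conj_val (f i) (\<sigma> x $ i)
         + conj_val (f i) (\<tau> x $ i)) + C0 * D i (\<sigma> x $ i) (\<tau> x $ i)"
          using dual_admissibleD(2)[OF \<sigma>, of i] dual_admissibleD(2)[OF \<tau>, of i]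
        proof eventually_elim
          case (elim x)
          have "D i (\<sigma> x $ i) (\<tau> x $ i) \<ge> 0"
            unfolding D_def by (rule conj_midpoint(2)[OF elim])
          then have "C i * D i (\<sigma> x $ i) (\<tau> x $ i) \<le> C0 * D i (\<sigma> x $ i) (\<tau> x $ i)"
            by (intro mult_right_mono C0)
          then show ?case using C_est[OF elim] by simp
        qed
      qed
      also have "\<dots> = e * ((1 + 2 * f i 0) * measure M (space M) + (LINT x|M. conj_val (f i) (\<sigma> x $ i))
           + (LINT x|M. conj_val (f i) (\<tau> x $ i))) + C0 * (LINT x|M. D i (\<sigma> x $ i) (\<tau> x $ i))"
        using i\<sigma> i\<tau> iD by (simp add: mult.commute)
      finally show ?thesis .
    qed
    have "(LINT x|M. norm (\<sigma> x - \<tau> x)) \<le> (LINT x|M. (\<Sum>i\<in>UNIV. \<bar>\<sigma> x $ i - \<tau> x $ i\<bar>))"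
    proof (rule integral_mono')
      show "integrable M (\<lambda>x. \<Sum>i\<in>UNIV. \<bar>\<sigma> x $ i - \<tau> x $ i\<bar>)"
        using admissible_integrable[OF \<sigma>] admissible_integrable[OF \<tau>] by auto
      show "norm (\<sigma> x - \<tau> x) \<le> (\<Sum>i\<in>UNIV. \<bar>\<sigma> x $ i - \<tau> x $ i\<bar>)" for x
        using norm_le_l1_cart[of "\<sigma> x - \<tau> x"] by simp
      show "0 \<le> (\<Sum>i\<in>UNIV. \<bar>\<sigma> x $ i - \<tau> x $ i\<bar>)" for x
        by (simp add: sum_nonneg)
    qed
    also have "\<dots> = (\<Sum>i\<in>UNIV. LINT x|M. \<bar>\<sigma> x $ i - \<tau> x $ i\<bar>)"
      using admissible_integrable[OF \<sigma>] admissible_integrable[OF \<tau>]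
      by (intro Bochner_Integration.integral_sum) auto
    also have "\<dots> \<le> (\<Sum>i\<in>UNIV. e * ((1 + 2 * f i 0) * measure M (space M)
        + (LINT x|M. conj_val (f i) (\<sigma> x $ i))
        + (LINT x|M. conj_val (f i) (\<tau> x $ i))) + C0 * (LINT x|M. D i (\<sigma> x $ i) (\<tau> x $ i)))"
      by (intro sum_mono comp)
    also have "\<dots> = e * ((\<Sum>i\<in>UNIV. (1 + 2 * f i 0) * measure M (space M)) + E \<sigma> + E \<tau>)
        + C0 * (\<Sum>i\<in>UNIV. LINT x|M. D i (\<sigma> x $ i) (\<tau> x $ i))"
      by (simp only: sum.distrib sum_distrib_left[symmetric] conj_energy_def)
    also have "(\<Sum>i\<in>UNIV. LINT x|M. D i (\<sigma> x $ i) (\<tau> x $ i)) = E \<sigma> + E \<tau> - 2 * E (mid \<sigma> \<tau>)"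
      unfolding D_def conj_energy_def using i\<sigma> i\<tau> im
      by (simp add: sum.distrib sum_subtractf sum_distrib_left)
    finally show ?thesis .
  qed
  with C00 show ?thesis by blast
qed

text \<open>Young's inequality for the pair \<open>\<tau>\<close> and \<open>2 v\<close> absorbs half of the energy, which makes the dual
functional coercive.\<close>
lemma energy_bound:
  assumes \<tau>: "adm \<tau>" and v: "finite_modular M f v"
  shows "E \<tau> \<le> (\<Sum>i\<in>UNIV. LINT x|M. f i (2 * v x $ i)) - 2 * L v \<tau>"
proof -
  have "2 * (LINT x|M. \<tau> x $ i * v x $ i) \<le>
      (LINT x|M. conj_val (f i) (\<tau> x $ i)) + (LINT x|M. f i (2 * v x $ i))" for i
  proof -
    have "(LINT x|M. 2 * (\<tau> x $ i * v x $ i)) \<le> (LINT x|M. conj_val (f i) (\<tau> x $ i) + f i (2 * v x $ i))"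
    proof (rule integral_mono_AE)
      show "AE x in M. 2 * (\<tau> x $ i * v x $ i) \<le> conj_val (f i) (\<tau> x $ i) + f i (2 * v x $ i)"
        using dual_admissibleD(2)[OF \<tau>, of i]
      proof eventually_elim
        case (elim x)
        show ?case using fenchel_young[OF elim, of "2 * v x $ i"] by simp
      qed
    qed (use dual_pairing_integrable[OF \<tau> v] dual_admissibleD(3)[OF \<tau>] finite_modularD(2)[OF v] in auto)
    then show ?thesis
      using dual_admissibleD(3)[OF \<tau>] finite_modularD(2)[OF v] by simp
  qed
  then have "(\<Sum>i\<in>UNIV. 2 * (LINT x|M. \<tau> x $ i * v x $ i)) \<le>
      (\<Sum>i\<in>UNIV. (LINT x|M. conj_val (f i) (\<tau> x $ i)) + (LINT x|M. f i (2 * v x $ i)))"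
    by (intro sum_mono)
  then show ?thesis
    by (simp add: sep_lagrangian_def dual_inner_integral(2)[OF \<tau> v] conj_energy_def sum.distrib
        sum_distrib_left[symmetric])
qed

lemma gap_measurable:
  assumes [measurable]: "(\<lambda>x. \<tau> x $ i) \<in> borel_measurable M" "(\<lambda>x. v x $ i) \<in> borel_measurable M"
  shows "(\<lambda>x. fenchel_gap (f i) (v x $ i) (\<tau> x $ i)) \<in> borel_measurable M"
proof -
  have [measurable]: "f i \<in> borel_measurable borel"
    by (intro borel_measurable_continuous_onI continuous_at_imp_continuous_on ballI DERIV_isCont[OF f_deriv])
  show ?thesis unfolding fenchel_gap_eq by measurable
qed

text \<open>The Lagrangian is the primal energy minus the integral of a nonnegative function that is lower
semicontinuous in the dual field. Weak duality and upper semicontinuity are both read off from this.\<close>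
lemma lagrangian_eq_gap:
  assumes \<tau>: "adm \<tau>" and v: "finite_modular M f v"
  shows "(\<integral>\<^sup>+x. (\<Sum>i\<in>UNIV. fenchel_gap (f i) (v x $ i) (\<tau> x $ i)) \<partial>M)
     = ennreal ((\<Sum>i\<in>UNIV. LINT x|M. f i (v x $ i)) - L v \<tau>)"
    and "L v \<tau> \<le> (\<Sum>i\<in>UNIV. LINT x|M. f i (v x $ i))"
proof -
  define h where "h i x = conj_val (f i) (\<tau> x $ i) - (\<tau> x $ i * v x $ i - f i (v x $ i))" for i x
  have ih: "integrable M (h i)" for i
    unfolding h_def using dual_admissibleD(3)[OF \<tau>] dual_pairing_integrable[OF \<tau> v] finite_modularD(3)[OF v]
    by (intro Bochner_Integration.integrable_diff)
  have ae: "AE x in M. 0 \<le> h i x \<and> fenchel_gap (f i) (v x $ i) (\<tau> x $ i) = ennreal (h i x)" for i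
    using dual_admissibleD(2)[OF \<tau>, of i]
  proof eventually_elim
    case (elim x)
    then show ?case
      using fenchel_young[OF elim, of "v x $ i"] fenchel_gap_dom[OF elim] by (simp add: h_def)
  qed
  have int: "(\<integral>\<^sup>+x. fenchel_gap (f i) (v x $ i) (\<tau> x $ i) \<partial>M) = ennreal (integral\<^sup>L M (h i))" for i
  proof -
    have "(\<integral>\<^sup>+x. fenchel_gap (f i) (v x $ i) (\<tau> x $ i) \<partial>M) = (\<integral>\<^sup>+x. ennreal (h i x) \<partial>M)"
      by (rule nn_integral_cong_AE) (use ae[of i] in auto)
    also have "\<dots> = ennreal (integral\<^sup>L M (h i))"
      by (rule nn_integral_eq_integral[OF ih]) (use ae[of i] in auto)
    finally show ?thesis .
  qed
  have h0: "integral\<^sup>L M (h i) \<ge> 0" for i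
    by (rule integral_nonneg_AE) (use ae[of i] in auto)
  have sum: "(\<Sum>i\<in>UNIV. integral\<^sup>L M (h i)) = (\<Sum>i\<in>UNIV. LINT x|M. f i (v x $ i)) - L v \<tau>"
    unfolding sep_lagrangian_def dual_inner_integral(2)[OF \<tau> v] conj_energy_def h_def
    using dual_admissibleD(3)[OF \<tau>] dual_pairing_integrable[OF \<tau> v] finite_modularD(3)[OF v]
    by (simp add: sum.distrib sum_subtractf)
  show "L v \<tau> \<le> (\<Sum>i\<in>UNIV. LINT x|M. f i (v x $ i))"
    using sum_nonneg[of UNIV "\<lambda>i. integral\<^sup>L M (h i)"] h0 sum by simp
  have "(\<integral>\<^sup>+x. (\<Sum>i\<in>UNIV. fenchel_gap (f i) (v x $ i) (\<tau> x $ i)) \<partial>M)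
     = (\<Sum>i\<in>UNIV. \<integral>\<^sup>+x. fenchel_gap (f i) (v x $ i) (\<tau> x $ i) \<partial>M)"
    using dual_admissibleD(1)[OF \<tau>] finite_modularD(1)[OF v]
    by (intro nn_integral_sum gap_measurable)
  also have "\<dots> = ennreal (\<Sum>i\<in>UNIV. integral\<^sup>L M (h i))"
    unfolding int by (rule sum_ennreal) (rule h0)
  finally show "(\<integral>\<^sup>+x. (\<Sum>i\<in>UNIV. fenchel_gap (f i) (v x $ i) (\<tau> x $ i)) \<partial>M)
     = ennreal ((\<Sum>i\<in>UNIV. LINT x|M. f i (v x $ i)) - L v \<tau>)" unfolding sum .
qed

lemma sum_liminf_le:
  fixes a :: "'n \<Rightarrow> nat \<Rightarrow> ennreal"
  assumes "finite I"
  shows "(\<Sum>i\<in>I. liminf (a i)) \<le> liminf (\<lambda>n. \<Sum>i\<in>I. a i n)"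
  using assms
proof (induction I)
  case empty
  then show ?case by simp
next
  case (insert j I)
  have "liminf (a j) + (\<Sum>i\<in>I. liminf (a i)) \<le> liminf (a j) + liminf (\<lambda>n. \<Sum>i\<in>I. a i n)"
    using insert by (intro add_left_mono)
  also have "\<dots> \<le> liminf (\<lambda>n. a j n + (\<Sum>i\<in>I. a i n))"
    unfolding liminf_SUP_INF
  proof (subst ennreal_SUP_add[symmetric], goal_cases)
    case 1
    show ?case by (rule incseq_SucI) (auto intro!: INF_superset_mono)
  next
    case 2
    show ?case by (rule incseq_SucI) (auto intro!: INF_superset_mono)
  next
    case 3
    show ?case
      by (intro SUP_mono) (auto intro!: INF_greatest add_mono INF_lower)
  qed
  finally show ?case using insert by simp
qed

lemma gap_fatou:
  assumes T: "\<And>n. adm (T n)" and \<tau>: "\<And>i. (\<lambda>x. \<tau> x $ i) \<in> borel_measurable M"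
    and lim: "AE x in M. (\<lambda>n. T n x) \<longlonglongrightarrow> \<tau> x"
    and v: "finite_modular M f v" and m: "\<forall>\<^sub>F n in sequentially. m \<le> L v (T n)"
  shows "(\<integral>\<^sup>+x. (\<Sum>i\<in>UNIV. fenchel_gap (f i) (v x $ i) (\<tau> x $ i)) \<partial>M)
     \<le> ennreal ((\<Sum>i\<in>UNIV. LINT x|M. f i (v x $ i)) - m)"
proof -
  define G where "G \<sigma> x = (\<Sum>i\<in>UNIV. fenchel_gap (f i) (v x $ i) (\<sigma> x $ i))" for \<sigma> x
  have "(\<integral>\<^sup>+x. G \<tau> x \<partial>M) \<le> (\<integral>\<^sup>+x. liminf (\<lambda>n. G (T n) x) \<partial>M)"
  proof (rule nn_integral_mono_AE)
    show "AE x in M. G \<tau> x \<le> liminf (\<lambda>n. G (T n) x)"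
      using lim
    proof eventually_elim
      case (elim x)
      have "G \<tau> x \<le> (\<Sum>i\<in>UNIV. liminf (\<lambda>n. fenchel_gap (f i) (v x $ i) (T n x $ i)))"
        unfolding G_def by (intro sum_mono fenchel_gap_lsc tendsto_vec_nth elim)
      also have "\<dots> \<le> liminf (\<lambda>n. G (T n) x)"
        unfolding G_def by (rule sum_liminf_le) simp
      finally show ?case .
    qed
  qed
  also have "\<dots> \<le> liminf (\<lambda>n. \<integral>\<^sup>+x. G (T n) x \<partial>M)"
  proof (rule nn_integral_liminf)
    fix n
    show "G (T n) \<in> borel_measurable M"
      unfolding G_def using dual_admissibleD(1)[OF T] finite_modularD(1)[OF v]
      by (intro borel_measurable_sum gap_measurable)
  qed
  also have "\<dots> \<le> limsup (\<lambda>n. \<integral>\<^sup>+x. G (T n) x \<partial>M)"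
    by (rule Liminf_le_Limsup) simp
  also have "\<dots> \<le> ennreal ((\<Sum>i\<in>UNIV. LINT x|M. f i (v x $ i)) - m)"
  proof (rule Limsup_bounded)
    show "\<forall>\<^sub>F n in sequentially. (\<integral>\<^sup>+x. G (T n) x \<partial>M)
        \<le> ennreal ((\<Sum>i\<in>UNIV. LINT x|M. f i (v x $ i)) - m)"
      using m
      by eventually_elim (unfold G_def lagrangian_eq_gap(1)[OF T v], rule ennreal_leI, simp)
  qed
  finally show ?thesis by (simp add: G_def)
qed

lemma zero_modular: "finite_modular M f (\<lambda>x. 0)"
  by (simp add: finite_modular_def)

text \<open>Taken with \<open>v = 0\<close>, the gap is the conjugate up to a constant, and it is infinite outside the
effective domain. Fatou bounds its integral for the limit, so the limit takes values in the effective
domains a.e. although these need not be closed.\<close>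
lemma limit_admissible:
  assumes T: "\<And>n. adm (T n)" and \<tau>: "\<And>i. (\<lambda>x. \<tau> x $ i) \<in> borel_measurable M"
    and lim: "AE x in M. (\<lambda>n. T n x) \<longlonglongrightarrow> \<tau> x"
    and K: "\<forall>\<^sub>F n in sequentially. E (T n) \<le> K"
  shows "adm \<tau>"
proof -
  have "\<forall>\<^sub>F n in sequentially. - K \<le> L (\<lambda>x. 0) (T n)"
    using K by eventually_elim (simp add: sep_lagrangian_def)
  from gap_fatou[OF T \<tau> lim zero_modular this]
  have fin: "(\<integral>\<^sup>+x. (\<Sum>i\<in>UNIV. fenchel_gap (f i) 0 (\<tau> x $ i)) \<partial>M) < \<infinity>"
    by (simp add: le_less_trans)
  show ?thesis
    unfolding dual_admissible_def
  proof (intro allI conjI)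
    fix i
    have [measurable]: "(\<lambda>x. \<tau> x $ i) \<in> borel_measurable M" by (rule \<tau>)
    show "(\<lambda>x. \<tau> x $ i) \<in> borel_measurable M" by (rule \<tau>)
    have "(\<integral>\<^sup>+x. fenchel_gap (f i) 0 (\<tau> x $ i) \<partial>M) \<le> (\<integral>\<^sup>+x. (\<Sum>i\<in>UNIV. fenchel_gap (f i) 0 (\<tau> x $ i)) \<partial>M)"
      by (intro nn_integral_mono member_le_sum) auto
    then have fini: "(\<integral>\<^sup>+x. fenchel_gap (f i) 0 (\<tau> x $ i) \<partial>M) < \<infinity>"
      using fin by (rule le_less_trans)
    have meas: "(\<lambda>x. fenchel_gap (f i) 0 (\<tau> x $ i)) \<in> borel_measurable M"
      using gap_measurable[of \<tau> i "\<lambda>x. 0"] \<tau> by simp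
    have ae: "AE x in M. fenchel_gap (f i) 0 (\<tau> x $ i) \<noteq> \<infinity>"
      by (rule nn_integral_PInf_AE[OF meas]) (use fini in simp)
    then show dom: "AE x in M. \<tau> x $ i \<in> conj_dom (f i)"
      by eventually_elim (rule fenchel_gap_finite)
    have "integrable M (\<lambda>x. conj_val (f i) (\<tau> x $ i) + f i 0)"
    proof (rule integrableI_nonneg)
      show "AE x in M. 0 \<le> conj_val (f i) (\<tau> x $ i) + f i 0"
        using dom
      proof eventually_elim
        case (elim x)
        then show ?case using conj_val_ge_0[OF elim] by simp
      qed
      have "(\<integral>\<^sup>+x. ennreal (conj_val (f i) (\<tau> x $ i) + f i 0) \<partial>M) \<le> (\<integral>\<^sup>+x. fenchel_gap (f i) 0 (\<tau> x $ i) \<partial>M)"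
      proof (rule nn_integral_mono_AE)
        show "AE x in M. ennreal (conj_val (f i) (\<tau> x $ i) + f i 0) \<le> fenchel_gap (f i) 0 (\<tau> x $ i)"
          using ae
        proof eventually_elim
          case (elim x)
          then show ?case using fenchel_gap_finite(2)[OF elim] by simp
        qed
      qed
      then show "(\<integral>\<^sup>+x. ennreal (conj_val (f i) (\<tau> x $ i) + f i 0) \<partial>M) < \<infinity>"
        using fini by (rule le_less_trans)
    qed measurable
    then have "integrable M (\<lambda>x. (conj_val (f i) (\<tau> x $ i) + f i 0) - f i 0)"
      by (intro Bochner_Integration.integrable_diff) auto
    then show "integrable M (\<lambda>x. conj_val (f i) (\<tau> x $ i))" by simp
  qed
qed

lemma limit_lagrangian:
  assumes T: "\<And>n. adm (T n)" and \<tau>: "adm \<tau>"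
    and lim: "AE x in M. (\<lambda>n. T n x) \<longlonglongrightarrow> \<tau> x"
    and v: "finite_modular M f v" and m: "\<forall>\<^sub>F n in sequentially. m \<le> L v (T n)"
  shows "m \<le> L v \<tau>"
proof -
  define F where "F = (\<Sum>i\<in>UNIV. LINT x|M. f i (v x $ i))"
  have "\<exists>n. m \<le> L v (T n)" using m by (meson eventually_sequentially order_refl)
  then have mF: "m \<le> F"
    unfolding F_def using lagrangian_eq_gap(2)[OF T v] order_trans by blast
  have "ennreal (F - L v \<tau>) \<le> ennreal (F - m)"
    using gap_fatou[OF T dual_admissibleD(1)[OF \<tau>] lim v m] lagrangian_eq_gap(1)[OF \<tau> v]
    by (simp add: F_def)
  then show ?thesis using mF by (simp add: ennreal_le_iff)
qed

lemma zero_admissible: "adm (\<lambda>x. 0)"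
proof -
  have "0 \<in> conj_dom (f i)" for i
  proof -
    obtain B where B: "\<And>t. B \<le> f i t" using f_lower by metis
    show ?thesis by (rule conj_val_least(1)[of 0 "f i" "- B"]) (use B in simp)
  qed
  then show ?thesis by (simp add: dual_admissible_def)
qed

text \<open>If the Lagrangians of \<open>\<sigma>\<close> and \<open>\<tau>\<close> are at least \<open>m - \<delta>\<close> for all competitors, \<open>m\<close> being the supremum
of such values, then the midpoint has at least the value \<open>m - \<delta>\<close> plus half the convexity defect, so the defect
is at most \<open>2 \<delta>\<close>. By the \<open>L\<^sup>1\<close>-estimate such fields are close to each other. This yields uniqueness
(\<open>\<delta> = 0\<close>) and makes maximizing sequences Cauchy in \<open>L\<^sup>1\<close>, so that a subsequence converges
a.e.\<close>
theorem dual_problem_uniquely_solvable: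
  assumes V: "V \<noteq> {}" "\<And>v. v \<in> V \<Longrightarrow> finite_modular M f v"
  shows "\<exists>\<tau> m. adm \<tau> \<and> (\<forall>v\<in>V. m \<le> L v \<tau>) \<and>
    (\<forall>\<sigma> m'. adm \<sigma> \<longrightarrow> (\<forall>v\<in>V. m' \<le> L v \<sigma>) \<longrightarrow> m' \<le> m) \<and>
    (\<forall>\<sigma>. adm \<sigma> \<longrightarrow> (\<forall>v\<in>V. m \<le> L v \<sigma>) \<longrightarrow> (AE x in M. \<sigma> x = \<tau> x))"
proof -
  obtain v0 where v0: "v0 \<in> V" using V(1) by blast
  define S where "S = {m. \<exists>\<tau>. adm \<tau> \<and> (\<forall>v\<in>V. m \<le> L v \<tau>)}"
  define m where "m = Sup S"
  have S_ne: "- E (\<lambda>x. 0) \<in> S"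
    unfolding S_def using zero_admissible by (auto simp: sep_lagrangian_def intro!: exI[of _ "\<lambda>x. 0"])
  have S_bdd: "bdd_above S"
  proof (rule bdd_aboveI)
    fix r assume "r \<in> S"
    then obtain \<tau> where "adm \<tau>" "r \<le> L v0 \<tau>" using v0 by (auto simp: S_def)
    then show "r \<le> (\<Sum>i\<in>UNIV. LINT x|M. f i (v0 x $ i))"
      using lagrangian_eq_gap(2)[OF _ V(2)[OF v0]] by force
  qed
  have upper: "r \<le> m" if "adm \<sigma>" "\<And>v. v \<in> V \<Longrightarrow> r \<le> L v \<sigma>" for \<sigma> r
    unfolding m_def by (rule cSup_upper[OF _ S_bdd]) (use that in \<open>auto simp: S_def\<close>)
  have defect: "E \<sigma> + E \<tau> - 2 * E (mid \<sigma> \<tau>) \<le> 2 * \<delta>"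
    if \<sigma>: "adm \<sigma>" "\<And>v. v \<in> V \<Longrightarrow> m - \<delta> \<le> L v \<sigma>" and \<tau>: "adm \<tau>" "\<And>v. v \<in> V \<Longrightarrow> m - \<delta> \<le> L v \<tau>"
    for \<sigma> \<tau> \<delta>
  proof -
    have "m - \<delta> + (E \<sigma> + E \<tau> - 2 * E (mid \<sigma> \<tau>)) / 2 \<le> m"
    proof (rule upper[OF midpoint_admissible[OF \<sigma>(1) \<tau>(1)]])
      fix v assume v: "v \<in> V"
      show "m - \<delta> + (E \<sigma> + E \<tau> - 2 * E (mid \<sigma> \<tau>)) / 2 \<le> L v (mid \<sigma> \<tau>)"
        using lagrangian_midpoint[OF \<sigma>(1) \<tau>(1) V(2)[OF v]] \<sigma>(2)[OF v] \<tau>(2)[OF v] by argo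
    qed
    then show ?thesis by simp
  qed
  define K where "K = (\<Sum>i\<in>UNIV. LINT x|M. f i (2 * v0 x $ i)) - 2 * (m - 1)"
  have E_le: "E \<tau> \<le> K" if "adm \<tau>" "\<And>v. v \<in> V \<Longrightarrow> m - \<delta> \<le> L v \<tau>" "\<delta> \<le> 1" for \<tau> \<delta>
    using energy_bound[OF that(1) V(2)[OF v0]] that(2)[OF v0] that(3) by (simp add: K_def)
  define c0 where "c0 = (\<Sum>i\<in>UNIV. (1 + 2 * f i 0) * measure M (space M))"
  define K' where "K' = \<bar>c0 + 2 * K\<bar> + 1"
  have K': "K' > 0" by (simp add: K'_def)
  have close: "\<exists>C\<ge>0. \<forall>\<sigma> \<tau> \<delta>. adm \<sigma> \<longrightarrow> adm \<tau> \<longrightarrow> \<delta> \<le> 1 \<longrightarrow> (\<forall>v\<in>V. m - \<delta> \<le> L v \<sigma>) \<longrightarrow>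
      (\<forall>v\<in>V. m - \<delta> \<le> L v \<tau>) \<longrightarrow> (LINT x|M. norm (\<sigma> x - \<tau> x)) \<le> e + C * \<delta>" if e: "0 < e" for e
  proof -
    obtain C where C: "C \<ge> 0" and est: "\<And>\<sigma> \<tau>. adm \<sigma> \<Longrightarrow> adm \<tau> \<Longrightarrow> (LINT x|M. norm (\<sigma> x - \<tau> x)) \<le>
      e / K' * (c0 + E \<sigma> + E \<tau>) + C * (E \<sigma> + E \<tau> - 2 * E (mid \<sigma> \<tau>))"
      using L1_distance_estimate[of "e / K'"] e K' unfolding c0_def by auto
    have "(LINT x|M. norm (\<sigma> x - \<tau> x)) \<le> e + (2 * C) * \<delta>"
      if \<sigma>: "adm \<sigma>" "\<forall>v\<in>V. m - \<delta> \<le> L v \<sigma>" and \<tau>: "adm \<tau>" "\<forall>v\<in>V. m - \<delta> \<le> L v \<tau>" and \<delta>: "\<delta> \<le> 1"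
      for \<sigma> \<tau> \<delta>
    proof -
      have "c0 + E \<sigma> + E \<tau> \<le> K'"
        using E_le[OF \<sigma>(1) _ \<delta>] E_le[OF \<tau>(1) _ \<delta>] \<sigma>(2) \<tau>(2) by (simp add: K'_def)
      then have "e / K' * (c0 + E \<sigma> + E \<tau>) \<le> e / K' * K'"
        using e K' by (intro mult_left_mono) auto
      moreover have "e / K' * K' = e" using K' by simp
      moreover have "C * (E \<sigma> + E \<tau> - 2 * E (mid \<sigma> \<tau>)) \<le> C * (2 * \<delta>)"
        using \<sigma> \<tau> by (intro mult_left_mono C defect) auto
      ultimately show ?thesis using est[OF \<sigma>(1) \<tau>(1)] by (simp add: mult.assoc mult.left_commute)
    qed
    then show ?thesis using C by (intro exI[of _ "2 * C"]) auto
  qed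
  have unique: "AE x in M. \<sigma> x = \<tau> x"
    if \<sigma>: "adm \<sigma>" "\<And>v. v \<in> V \<Longrightarrow> m \<le> L v \<sigma>" and \<tau>: "adm \<tau>" "\<And>v. v \<in> V \<Longrightarrow> m \<le> L v \<tau>" for \<sigma> \<tau>
  proof -
    have "(LINT x|M. norm (\<sigma> x - \<tau> x)) \<le> 0"
    proof (rule field_le_epsilon)
      fix e :: real assume "0 < e"
      from close[OF this] obtain C where
        "\<And>\<delta>. \<delta> \<le> 1 \<Longrightarrow> (\<forall>v\<in>V. m - \<delta> \<le> L v \<sigma>) \<Longrightarrow> (\<forall>v\<in>V. m - \<delta> \<le> L v \<tau>)
          \<Longrightarrow> (LINT x|M. norm (\<sigma> x - \<tau> x)) \<le> e + C * \<delta>"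
        using \<sigma>(1) \<tau>(1) by blast
      from this[of 0] show "(LINT x|M. norm (\<sigma> x - \<tau> x)) \<le> 0 + e"
        using \<sigma>(2) \<tau>(2) by simp
    qed
    moreover have "(LINT x|M. norm (\<sigma> x - \<tau> x)) \<ge> 0" by simp
    ultimately have "(LINT x|M. norm (\<sigma> x - \<tau> x)) = 0" by linarith
    moreover have "integrable M (\<lambda>x. norm (\<sigma> x - \<tau> x))"
      using admissible_vec_integrable[OF \<sigma>(1)] admissible_vec_integrable[OF \<tau>(1)] by auto
    ultimately have "AE x in M. norm (\<sigma> x - \<tau> x) = 0"
      by (subst integral_nonneg_eq_0_iff_AE[symmetric]) auto
    then show ?thesis by simp
  qed
  have "\<exists>\<tau>. adm \<tau> \<and> (\<forall>v\<in>V. m - 1 / real (Suc n) \<le> L v \<tau>)" for n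
  proof -
    have "m - 1 / real (Suc n) < Sup S" by (simp add: m_def)
    then obtain r where "r \<in> S" "m - 1 / real (Suc n) < r"
      using less_cSup_iff[OF _ S_bdd] S_ne by blast
    then show ?thesis unfolding S_def by force
  qed
  then obtain T where T: "\<And>n. adm (T n)" "\<And>n v. v \<in> V \<Longrightarrow> m - 1 / real (Suc n) \<le> L v (T n)"
    by metis
  have T_late: "m - 1 / real (Suc N) \<le> L v (T n)" if "v \<in> V" "N \<le> n" for v n N
  proof -
    have "1 / real (Suc n) \<le> 1 / real (Suc N)" using that by (simp add: frac_le)
    then show ?thesis using T(2)[OF that(1), of n] by linarith
  qed
  have cauchy: "\<exists>N. \<forall>i\<ge>N. \<forall>j\<ge>N. (LINT x|M. norm (T i x - T j x)) < e" if e: "e > 0" for e :: real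
  proof -
    obtain C where C: "C \<ge> 0" and est: "\<And>\<sigma> \<tau> \<delta>. adm \<sigma> \<Longrightarrow> adm \<tau> \<Longrightarrow> \<delta> \<le> 1 \<Longrightarrow> (\<forall>v\<in>V. m - \<delta> \<le> L v \<sigma>) \<Longrightarrow>
      (\<forall>v\<in>V. m - \<delta> \<le> L v \<tau>) \<Longrightarrow> (LINT x|M. norm (\<sigma> x - \<tau> x)) \<le> e / 2 + C * \<delta>"
      using close[of "e / 2"] e by auto
    obtain N :: nat where "2 * C / e < real N" using reals_Archimedean2 by blast
    then have N: "C * (1 / real (Suc N)) < e / 2" using e by (simp add: field_simps)
    have "(LINT x|M. norm (T i x - T j x)) < e" if "i \<ge> N" "j \<ge> N" for i j
    proof -
      have "(LINT x|M. norm (T i x - T j x)) \<le> e / 2 + C * (1 / real (Suc N))"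
        using that by (intro est T ballI T_late) auto
      then show ?thesis using N by linarith
    qed
    then show ?thesis by blast
  qed
  obtain r where r: "strict_mono r" and ae: "AE x in M. Cauchy (\<lambda>i. T (r i) x)"
    using cauchy_L1_AE_cauchy_subseq[of M T, OF admissible_vec_integrable[OF T(1)] cauchy] by blast
  define \<tau> where "\<tau> x = lim (\<lambda>i. T (r i) x)" for x
  have [measurable]: "T n \<in> borel_measurable M" for n
    using admissible_vec_integrable[OF T(1)] by auto
  have \<tau>_meas: "\<tau> \<in> borel_measurable M" unfolding \<tau>_def by measurable
  have \<tau>_meas_i: "(\<lambda>x. \<tau> x $ i) \<in> borel_measurable M" for i
    using measurable_compose[OF \<tau>_meas borel_measurable_continuous_onI[of "\<lambda>y. y $ i"]]
    by (simp add: continuous_on_component)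
  have lim: "AE x in M. (\<lambda>i. T (r i) x) \<longlonglongrightarrow> \<tau> x"
    using ae by eventually_elim (simp add: \<tau>_def Cauchy_convergent_iff convergent_LIMSEQ_iff)
  have adm_\<tau>: "adm \<tau>"
  proof (rule limit_admissible[OF T(1) \<tau>_meas_i lim])
    show "\<forall>\<^sub>F n in sequentially. E (T (r n)) \<le> K"
      by (intro always_eventually allI E_le[OF T(1) T(2)]) auto
  qed
  have low: "m \<le> L v \<tau>" if v: "v \<in> V" for v
  proof (rule field_le_epsilon)
    fix e :: real assume "0 < e"
    then obtain N where N: "1 / real (Suc N) < e" using nat_approx_posE by blast
    have "m - e \<le> L v \<tau>"
    proof (rule limit_lagrangian[OF T(1) adm_\<tau> lim V(2)[OF v]])
      show "\<forall>\<^sub>F n in sequentially. m - e \<le> L v (T (r n))"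
        unfolding eventually_sequentially
      proof (intro exI allI impI)
        fix n assume "N \<le> n"
        then have "N \<le> r n" using seq_suble[OF r, of n] by linarith
        from T_late[OF v this] N show "m - e \<le> L v (T (r n))" by linarith
      qed
    qed
    then show "m \<le> L v \<tau> + e" by simp
  qed
  show ?thesis
  proof (intro exI conjI allI ballI impI)
    show "adm \<tau>" by (rule adm_\<tau>)
    show "m \<le> L v \<tau>" if "v \<in> V" for v by (rule low[OF that])
    show "m' \<le> m" if "adm \<sigma>" "\<forall>v\<in>V. m' \<le> L v \<sigma>" for \<sigma> m'
      by (rule upper[OF that(1)]) (use that(2) in blast)
    show "AE x in M. \<sigma> x = \<tau> x" if "adm \<sigma>" "\<forall>v\<in>V. m \<le> L v \<sigma>" for \<sigma>
      by (rule unique[OF that(1) _ adm_\<tau> low]) (use that(2) in blast)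
  qed
qed

end

section \<open>The fundamental lemma of the calculus of variations\<close>

text \<open>The smooth function \<open>exp (- 1 / t)\<close>, flat at 0, is \<open>flat_exp 0\<close>. The family with the additional factor
\<open>t\<^sup>-\<^sup>k\<close> is closed under differentiation up to linear combinations, which gives smoothness of all orders
by one induction.\<close>
definition flat_exp :: "nat \<Rightarrow> real \<Rightarrow> real" where
  "flat_exp k t = (if t \<le> 0 then 0 else inverse t ^ k * exp (- inverse t))"

lemma flat_exp_tendsto_0: "(flat_exp k \<longlongrightarrow> 0) (at_right 0)"
proof -
  have "((\<lambda>y::real. y ^ k / exp y) \<longlongrightarrow> 0) at_top" by (rule tendsto_power_div_exp_0)
  then have "((\<lambda>t::real. inverse t ^ k / exp (inverse t)) \<longlongrightarrow> 0) (at_right 0)"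
    by (rule filterlim_compose[OF _ filterlim_inverse_at_top_right])
  moreover have "\<forall>\<^sub>F t in at_right 0. inverse t ^ k / exp (inverse t) = flat_exp k t"
    unfolding eventually_at_right_field
    by (intro exI[of _ 1]) (auto simp: flat_exp_def exp_minus divide_inverse)
  ultimately show ?thesis by (rule Lim_transform_eventually)
qed

lemma flat_exp_deriv:
  "(flat_exp k has_real_derivative flat_exp (k + 2) t - k * flat_exp (k + 1) t) (at t)"
proof -
  consider "t < 0" | "t = 0" | "t > 0" by linarith
  then show ?thesis
  proof cases
    case 1
    have "((\<lambda>t. 0) has_real_derivative 0) (at t)" by simp
    then have "(flat_exp k has_real_derivative 0) (at t)"
      by (rule has_field_derivative_transform_within_open[of _ _ _ "{..<0}"])
        (use 1 in \<open>auto simp: flat_exp_def\<close>)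
    then show ?thesis using 1 by (simp add: flat_exp_def)
  next
    case 2
    have R: "(flat_exp k has_real_derivative 0) (at_right 0)"
      unfolding has_field_derivative_iff
    proof (rule Lim_transform_eventually[OF flat_exp_tendsto_0[of "Suc k"]])
      show "\<forall>\<^sub>F t in at_right 0. flat_exp (Suc k) t = (flat_exp k t - flat_exp k 0) / (t - 0)"
        unfolding eventually_at_right_field
        by (intro exI[of _ 1]) (auto simp: flat_exp_def field_simps)
    qed
    have "((\<lambda>t. 0) has_real_derivative 0) (at_left 0)" by simp
    then have L: "(flat_exp k has_real_derivative 0) (at_left 0)"
      unfolding has_field_derivative_iff
      by (rule Lim_transform_eventually)
        (auto simp: flat_exp_def eventually_at_left_field intro!: exI[of _ "-1"])
    have "(flat_exp k has_real_derivative 0) (at 0)"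
      using L R unfolding has_field_derivative_iff by (simp add: filterlim_at_split)
    then show ?thesis using 2 by (simp add: flat_exp_def)
  next
    case 3
    have "((\<lambda>t. inverse t ^ k) has_real_derivative real k * (- (inverse t ^ 2)) * inverse t ^ (k - 1)) (at t)"
      by (rule DERIV_cong[OF DERIV_power[OF DERIV_inverse]]) (use 3 in \<open>simp_all add: power2_eq_square\<close>)
    moreover have "((\<lambda>t. exp (- inverse t)) has_real_derivative exp (- inverse t) * (- (- (inverse t ^ 2)))) (at t)"
      by (rule DERIV_cong[OF DERIV_fun_exp[OF DERIV_minus[OF DERIV_inverse]]]) (use 3 in \<open>simp_all add: power2_eq_square\<close>)
    ultimately have "((\<lambda>t. inverse t ^ k * exp (- inverse t)) has_real_derivative
        real k * (- (inverse t ^ 2)) * inverse t ^ (k - 1) * exp (- inverse t)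
        + exp (- inverse t) * (- (- (inverse t ^ 2))) * inverse t ^ k) (at t)"
      by (rule DERIV_mult)
    also have "real k * (- (inverse t ^ 2)) * inverse t ^ (k - 1) * exp (- inverse t)
        + exp (- inverse t) * (- (- (inverse t ^ 2))) * inverse t ^ k
        = flat_exp (k + 2) t - k * flat_exp (k + 1) t"
      using 3 by (cases k) (simp_all add: flat_exp_def power2_eq_square algebra_simps)
    finally have "((\<lambda>t. inverse t ^ k * exp (- inverse t)) has_real_derivative
        flat_exp (k + 2) t - k * flat_exp (k + 1) t) (at t)" .
    then show ?thesis
      by (rule has_field_derivative_transform_within_open[of _ _ _ "{0<..}"])
        (use 3 in \<open>auto simp: flat_exp_def\<close>)
  qed
qed

lemma Ck_continuous: "Ck k \<phi> \<Longrightarrow> continuous_on UNIV \<phi>"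
  by (cases k) (auto intro: differentiable_imp_continuous_on)

lemma Ck_SucD: "Ck (Suc k) \<phi> \<Longrightarrow> Ck k \<phi>"
  by (induction k arbitrary: \<phi>) (auto intro: differentiable_imp_continuous_on)

lemma partial_eqI: "(\<phi> has_derivative D) (at x) \<Longrightarrow> partial i \<phi> x = D (axis i 1)"
  unfolding partial_def by (drule frechet_derivative_at) simp

lemma Ck_has_derivative:
  assumes "Ck (Suc k) \<phi>"
  shows "(\<phi> has_derivative frechet_derivative \<phi> (at x)) (at x)"
  using assms by (simp add: differentiable_on_def frechet_derivative_works[symmetric])

lemma Ck_zero: "Ck k (\<lambda>x. 0)"
proof (induction k)
  case (Suc k)
  have "partial i (\<lambda>x. 0) = (\<lambda>x. 0)" for i
    by (rule ext) (rule partial_eqI[of _ "\<lambda>x. 0"], simp)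
  then show ?case using Suc by simp
qed simp

lemma Ck_add: "Ck k \<phi> \<Longrightarrow> Ck k \<psi> \<Longrightarrow> Ck k (\<lambda>x. \<phi> x + \<psi> x)"
proof (induction k arbitrary: \<phi> \<psi>)
  case (Suc k)
  have "partial i (\<lambda>x. \<phi> x + \<psi> x) = (\<lambda>x. partial i \<phi> x + partial i \<psi> x)" for i
  proof
    fix x
    show "partial i (\<lambda>x. \<phi> x + \<psi> x) x = partial i \<phi> x + partial i \<psi> x"
      unfolding partial_def[of i \<phi>] partial_def[of i \<psi>]
      by (rule partial_eqI[OF has_derivative_add]) (rule Ck_has_derivative[OF Suc.prems(1)] Ck_has_derivative[OF Suc.prems(2)])+
  qed
  then show ?case using Suc by (auto intro: differentiable_on_add)
qed (auto intro: continuous_on_add)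

lemma Ck_mult: "Ck k \<phi> \<Longrightarrow> Ck k \<psi> \<Longrightarrow> Ck k (\<lambda>x. \<phi> x * \<psi> x)"
proof (induction k arbitrary: \<phi> \<psi>)
  case (Suc k)
  have "partial i (\<lambda>x. \<phi> x * \<psi> x) = (\<lambda>x. \<phi> x * partial i \<psi> x + partial i \<phi> x * \<psi> x)" for i
  proof
    fix x
    show "partial i (\<lambda>x. \<phi> x * \<psi> x) x = \<phi> x * partial i \<psi> x + partial i \<phi> x * \<psi> x"
      unfolding partial_def[of i \<phi>] partial_def[of i \<psi>]
      by (rule partial_eqI[OF has_derivative_mult]) (rule Ck_has_derivative[OF Suc.prems(1)] Ck_has_derivative[OF Suc.prems(2)])+
  qed
  moreover have "Ck k \<phi>" "Ck k \<psi>" using Suc.prems Ck_SucD by blast+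
  moreover have "Ck k (partial i \<phi>)" "Ck k (partial i \<psi>)" for i using Suc.prems by auto
  ultimately show ?case using Suc.prems by (auto intro!: differentiable_on_mult Ck_add Suc.IH)
qed (auto intro: continuous_on_mult)

lemma Ck_const: "Ck k (\<lambda>x. c)"
proof (cases k)
  case (Suc k')
  have "partial i (\<lambda>x. c) = (\<lambda>x. 0)" for i
    by (rule ext) (rule partial_eqI[of _ "\<lambda>x. 0"], simp)
  then show ?thesis using Suc Ck_zero by simp
qed simp

lemma Ck_flat_exp: "Ck k (\<lambda>x. flat_exp j (c * x $ i + d))"
proof (induction k arbitrary: j)
  case 0
  have "continuous_on UNIV (flat_exp j)"
    by (intro continuous_at_imp_continuous_on ballI DERIV_isCont[OF flat_exp_deriv])
  then have "continuous_on UNIV (\<lambda>x::real^2. flat_exp j (c * x $ i + d))"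
    by (rule continuous_on_compose2) (auto intro!: continuous_intros)
  then show ?case by simp
next
  case (Suc k)
  have D: "((\<lambda>x::real^2. flat_exp j (c * x $ i + d)) has_derivative
      (\<lambda>h. (flat_exp (j + 2) (c * x $ i + d) - j * flat_exp (j + 1) (c * x $ i + d)) * (c * h $ i))) (at x)" for x
  proof -
    have "((\<lambda>x::real^2. c * x $ i + d) has_derivative (\<lambda>h. c * h $ i)) (at x)"
      by (auto intro!: derivative_eq_intros bounded_linear_imp_has_derivative bounded_linear_vec_nth)
    from has_derivative_compose[OF this flat_exp_deriv[of j, unfolded has_field_derivative_def]]
    show ?thesis by (simp add: o_def)
  qed
  have "partial l (\<lambda>x. flat_exp j (c * x $ i + d)) = (\<lambda>x. (c * (axis l 1 :: real^2) $ i) *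
     (flat_exp (j + 2) (c * x $ i + d) + (- real j) * flat_exp (j + 1) (c * x $ i + d)))" for l
    by (rule ext, subst partial_eqI[OF D]) (simp add: algebra_simps)
  moreover have "(\<lambda>x::real^2. flat_exp j (c * x $ i + d)) differentiable_on UNIV"
    using D by (auto simp: differentiable_on_def differentiable_def)
  moreover have "Ck k (\<lambda>x. (c * (axis l 1 :: real^2) $ i) *
     (flat_exp (j + 2) (c * x $ i + d) + (- real j) * flat_exp (j + 1) (c * x $ i + d)))" for l
    by (intro Ck_mult Ck_add Ck_const Suc.IH)
  ultimately show ?case by simp
qed

text \<open>The product of the factors \<open>flat_exp 0 (n (x\<^sub>i - a\<^sub>i))\<close> and \<open>flat_exp 0 (n (b\<^sub>i - x\<^sub>i))\<close> over both coordinates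
vanishes off the open box and tends to 1 inside, since \<open>exp (- 1 / t)\<close> tends to 1 as \<open>t\<close> tends to
infinity.\<close>
lemma box_approximation:
  fixes a b :: "real^2"
  assumes "cbox a b \<subseteq> \<Omega>"
  obtains \<phi> where "\<And>n. \<phi> n \<in> test_functions \<Omega>" "\<And>n x. \<bar>\<phi> n x\<bar> \<le> indicator (box a b) x"
    "\<And>x. (\<lambda>n. \<phi> n x) \<longlonglongrightarrow> indicator (box a b) x"
proof -
  define g where "g n i x = flat_exp 0 (real n * x $ i + - (real n * a $ i)) *
     flat_exp 0 (- real n * x $ i + real n * b $ i)" for n i and x :: "real^2"
  define \<phi> where "\<phi> n x = g n 1 x * g n 2 x" for n x
  have fe: "0 \<le> flat_exp 0 t" "flat_exp 0 t \<le> 1" for t by (auto simp: flat_exp_def)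
  have box: "x \<in> box a b \<longleftrightarrow> (a $ 1 < x $ 1 \<and> x $ 1 < b $ 1) \<and> (a $ 2 < x $ 2 \<and> x $ 2 < b $ 2)" for x
    by (auto simp: mem_box_cart forall_2)
  have flat: "flat_exp 0 (real n * s) = 0" if "s \<le> 0" for n s
    using that by (simp add: flat_exp_def mult_nonneg_nonpos)
  have g_eq: "g n i x = flat_exp 0 (real n * (x $ i - a $ i)) * flat_exp 0 (real n * (b $ i - x $ i))" for n i x
    by (simp add: g_def algebra_simps)
  have g01: "0 \<le> g n i x" "g n i x \<le> 1" for n i x
    unfolding g_def by (intro mult_le_one mult_nonneg_nonneg fe)+
  have zero: "\<phi> n x = 0" if "x \<notin> box a b" for n x
  proof -
    have g0: "g n i x = 0" if "x $ i \<le> a $ i \<or> b $ i \<le> x $ i" for i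
      using that flat[of "x $ i - a $ i" n] flat[of "b $ i - x $ i" n] unfolding g_eq by auto
    have "(x $ 1 \<le> a $ 1 \<or> b $ 1 \<le> x $ 1) \<or> (x $ 2 \<le> a $ 2 \<or> b $ 2 \<le> x $ 2)"
      using that unfolding box by linarith
    then show ?thesis unfolding \<phi>_def using g0[of 1] g0[of 2] by (metis mult_zero_left mult_zero_right)
  qed
  have lim1: "(\<lambda>n. flat_exp 0 (real n * s)) \<longlonglongrightarrow> 1" if "s > 0" for s
  proof -
    have "(\<lambda>n. exp (- inverse (real n * s))) \<longlonglongrightarrow> exp (- 0)"
    proof (intro tendsto_intros)
      have "(\<lambda>n. inverse (real n) * inverse s) \<longlonglongrightarrow> 0 * inverse s"
        by (intro tendsto_intros lim_inverse_n)
      then show "(\<lambda>n. inverse (real n * s)) \<longlonglongrightarrow> 0" by simp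
    qed
    moreover have "\<forall>\<^sub>F n in sequentially. exp (- inverse (real n * s)) = flat_exp 0 (real n * s)"
      using eventually_gt_at_top[of 0]
    proof eventually_elim
      case (elim n)
      then have "real n * s > 0" using that by simp
      then show ?case by (simp add: flat_exp_def)
    qed
    ultimately show ?thesis by (simp add: Lim_transform_eventually)
  qed
  show thesis
  proof
    fix n
    have "Ck k (\<phi> n)" for k
      unfolding \<phi>_def g_def by (intro Ck_mult Ck_flat_exp)
    moreover have "supported_in \<Omega> (\<phi> n)"
      unfolding supported_in_def using zero assms box_subset_cbox[of a b]
      by (intro exI[of _ "cbox a b"]) auto
    ultimately show "\<phi> n \<in> test_functions \<Omega>" by (simp add: test_functions_def)
  next
    fix n x
    show "\<bar>\<phi> n x\<bar> \<le> indicator (box a b) x"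
    proof (cases "x \<in> box a b")
      case True
      have "0 \<le> \<phi> n x" "\<phi> n x \<le> 1"
        unfolding \<phi>_def by (intro mult_le_one mult_nonneg_nonneg g01)+
      then show ?thesis using True by simp
    qed (simp add: zero)
  next
    fix x
    show "(\<lambda>n. \<phi> n x) \<longlonglongrightarrow> indicator (box a b) x"
    proof (cases "x \<in> box a b")
      case True
      then have "(\<lambda>n. \<phi> n x) \<longlonglongrightarrow> (1 * 1) * (1 * 1)"
        unfolding \<phi>_def g_eq box by (intro tendsto_intros lim1) auto
      then show ?thesis using True by simp
    qed (simp add: zero)
  qed
qed

text \<open>Open boxes form an intersection-stable generator of the Borel sets, so the vanishing integrals
propagate to all Borel sets by induction and from there to Lebesgue sets.\<close>
lemma AE_zero_if_box_integrals_zero: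
  fixes h :: "'a::euclidean_space \<Rightarrow> real"
  assumes h: "integrable lebesgue h" and total: "integral\<^sup>L lebesgue h = 0"
    and box: "\<And>c d. set_lebesgue_integral lebesgue (box c d) h = 0"
  shows "AE x in lebesgue. h x = 0"
proof -
  interpret lebesgue: sigma_finite_measure "lebesgue :: 'a measure"
    by unfold_locales
      (use lborel.sigma_finite_countable in \<open>force simp: emeasure_completion main_part_sets\<close>)
  have h_set: "set_integrable lebesgue A h" if "A \<in> sets lebesgue" for A
    using integrable_mult_indicator[OF that h] by (simp add: set_integrable_def)
  have borel: "set_lebesgue_integral lebesgue A h = 0" if "A \<in> sets borel" for A
  proof -
    have "Int_stable (range (\<lambda>(a, b). box a b :: 'a set))"
      by (auto simp: Int_stable_def box_Int_box)
    moreover have "range (\<lambda>(a, b). box a b :: 'a set) \<subseteq> Pow UNIV" by auto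
    moreover have "A \<in> sigma_sets UNIV (range (\<lambda>(a, b). box a b))"
      using that unfolding borel_eq_box by simp
    ultimately show ?thesis
    proof (induction rule: sigma_sets_induct_disjoint)
      case (basic A)
      then show ?case using box by auto
    next
      case empty
      show ?case by (simp add: set_lebesgue_integral_def)
    next
      case (compl A)
      then have "A \<in> sets borel" by (simp add: borel_eq_box)
      then have A: "A \<in> sets lebesgue" by simp
      have "set_lebesgue_integral lebesgue (UNIV - A) h
          = (LINT x|lebesgue. h x - indicator A x *\<^sub>R h x)"
        unfolding set_lebesgue_integral_def
        by (rule Bochner_Integration.integral_cong) (auto simp: indicator_def)
      also have "\<dots> = integral\<^sup>L lebesgue h - set_lebesgue_integral lebesgue A h"
        using h h_set[OF A] by (simp add: set_lebesgue_integral_def set_integrable_def)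
      finally show ?case using total compl by simp
    next
      case (union F)
      then have "F i \<in> sets borel" for i by (auto simp: borel_eq_box)
      then have F: "F i \<in> sets lebesgue" for i by simp
      have "set_lebesgue_integral lebesgue (\<Union>i. F i) h = (\<Sum>i. set_lebesgue_integral lebesgue (F i) h)"
        using union(1) F
        by (intro lebesgue_integral_countable_add F h_set sets.countable_UN'') (auto simp: disjoint_family_on_def)
      then show ?case using union by simp
    qed
  qed
  show ?thesis
  proof (rule lebesgue.density_zero[OF h])
    fix S :: "'a set" assume S: "S \<in> sets lebesgue"
    then obtain B N where B: "B \<in> sets borel" "negligible N" "B \<union> N = S"
      by (rule sets_lebesgue_almost_borel)
    have "AE x in lebesgue. x \<in> S \<longleftrightarrow> x \<in> B"
      using B by (auto intro!: AE_I'[of N] simp: negligible_iff_null_sets)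
    then have "set_lebesgue_integral lebesgue S h = set_lebesgue_integral lebesgue B h"
      using S B h_set[of S] h_set[of B]
      by (intro set_integral_cong_set) (auto simp: set_borel_measurable_def set_integrable_def)
    then show "set_lebesgue_integral lebesgue S h = 0" using borel[OF B(1)] by simp
  qed
qed

lemma test_function_measurable: "\<phi> \<in> test_functions \<Omega> \<Longrightarrow> \<phi> \<in> borel_measurable borel"
  by (auto simp: test_functions_def intro!: borel_measurable_continuous_onI Ck_continuous)

lemma box_integral_zero:
  fixes g :: "real^2 \<Rightarrow> real"
  assumes \<Omega>: "open \<Omega>" and g: "locally_integrable \<Omega> g"
    and zero: "\<And>\<phi>. \<phi> \<in> test_functions \<Omega> \<Longrightarrow> (LINT x|lebesgue_on \<Omega>. g x * \<phi> x) = 0"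
    and sub: "cbox a b \<subseteq> \<Omega>"
  shows "set_lebesgue_integral lebesgue (box a b) g = 0"
proof -
  obtain \<phi> where \<phi>: "\<And>n. \<phi> n \<in> test_functions \<Omega>" "\<And>n x. \<bar>\<phi> n x\<bar> \<le> indicator (box a b) x"
    and lim: "\<And>x. (\<lambda>n. \<phi> n x) \<longlonglongrightarrow> indicator (box a b) x"
    using box_approximation[OF sub] by metis
  have "set_integrable lebesgue (cbox a b) g"
    using g sub by (simp add: locally_integrable_def)
  then have gi: "integrable lebesgue (\<lambda>x. indicator (box a b) x * g x)"
    using set_integrable_subset[of lebesgue "cbox a b" g "box a b"] box_subset_cbox[of a b]
    by (simp add: set_integrable_def)
  have eq: "g x * \<phi> n x = (indicator (box a b) x * g x) * \<phi> n x" for n x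
    using \<phi>(2)[of n x] by (auto simp: indicator_def)
  have [measurable]: "\<phi> n \<in> borel_measurable lebesgue" for n
    using test_function_measurable[OF \<phi>(1)] by (simp add: measurable_completion)
  have "(\<lambda>n. LINT x|lebesgue. g x * \<phi> n x) \<longlonglongrightarrow> (LINT x|lebesgue. indicator (box a b) x * g x)"
  proof (rule integral_dominated_convergence[of _ _ _ "\<lambda>x. \<bar>indicator (box a b) x * g x\<bar>"])
    show "(\<lambda>x. indicator (box a b) x * g x) \<in> borel_measurable lebesgue" using gi by auto
    then show "(\<lambda>x. g x * \<phi> n x) \<in> borel_measurable lebesgue" for n unfolding eq by measurable
    show "integrable lebesgue (\<lambda>x. \<bar>indicator (box a b) x * g x\<bar>)" using gi by simp
    show "AE x in lebesgue. (\<lambda>n. g x * \<phi> n x) \<longlonglongrightarrow> indicator (box a b) x * g x"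
    proof (rule AE_I2)
      fix x
      show "(\<lambda>n. g x * \<phi> n x) \<longlonglongrightarrow> indicator (box a b) x * g x"
        using tendsto_mult[OF tendsto_const[of "g x"] lim[of x]] by (simp only: mult.commute[of "g x"])
    qed
    show "AE x in lebesgue. norm (g x * \<phi> n x) \<le> \<bar>indicator (box a b) x * g x\<bar>" for n
    proof (rule AE_I2)
      fix x
      have "\<bar>g x\<bar> * \<bar>\<phi> n x\<bar> \<le> \<bar>g x\<bar> * indicator (box a b) x"
        by (intro mult_left_mono \<phi>(2)) auto
      then show "norm (g x * \<phi> n x) \<le> \<bar>indicator (box a b) x * g x\<bar>"
        by (simp add: abs_mult mult.commute)
    qed
  qed
  moreover have "(LINT x|lebesgue. g x * \<phi> n x) = 0" for n
  proof -
    have "indicator \<Omega> x *\<^sub>R (g x * \<phi> n x) = g x * \<phi> n x" for x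
    proof (cases "x \<in> \<Omega>")
      case False
      then have "x \<notin> box a b" using sub box_subset_cbox[of a b] by blast
      then show ?thesis using \<phi>(2)[of n x] by simp
    qed simp
    then show ?thesis
      using zero[OF \<phi>(1), of n] \<Omega>
      by (simp add: integral_restrict_space del: real_scaleR_def)
  qed
  ultimately have "(LINT x|lebesgue. indicator (box a b) x * g x) = 0"
    by (simp add: LIMSEQ_const_iff)
  then show ?thesis by (simp add: set_lebesgue_integral_def)
qed

text \<open>Localized to a box inside the domain, all integrals of \<open>g\<close> over subboxes vanish by approximation of
their indicators by test functions; countably many boxes exhaust the domain.\<close>
theorem fundamental_lemma_of_variations:
  fixes g :: "real^2 \<Rightarrow> real"
  assumes \<Omega>: "open \<Omega>" and g: "locally_integrable \<Omega> g"
    and zero: "\<And>\<phi>. \<phi> \<in> test_functions \<Omega> \<Longrightarrow> (LINT x|lebesgue_on \<Omega>. g x * \<phi> x) = 0"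
  shows "AE x in lebesgue_on \<Omega>. g x = 0"
proof -
  have local: "AE x in lebesgue. x \<in> box a b \<longrightarrow> g x = 0" if sub: "cbox a b \<subseteq> \<Omega>" for a b
  proof -
    define h where "h x = indicator (box a b) x * g x" for x
    have h_restrict: "set_lebesgue_integral lebesgue (box c d) h = 0" for c d
    proof -
      have "\<exists>c' d'. box c d \<inter> box a b = box c' d'"
        unfolding box_Int_box by blast
      then obtain c' d' where cd: "box c d \<inter> box a b = box c' d'" by blast
      have "set_lebesgue_integral lebesgue (box c d) h = set_lebesgue_integral lebesgue (box c' d') g"
        unfolding set_lebesgue_integral_def cd[symmetric]
        by (rule Bochner_Integration.integral_cong) (auto simp: h_def indicator_def)
      also have "\<dots> = 0"
      proof (cases "box c' d' = {}")
        case False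
        have "box c' d' \<subseteq> box a b" using cd by blast
        then have "closure (box c' d') \<subseteq> cbox a b"
          using box_subset_cbox[of a b] by (intro closure_minimal) auto
        then have "cbox c' d' \<subseteq> \<Omega>" using False sub by (simp add: closure_box)
        then show ?thesis using box_integral_zero[OF \<Omega> g zero] by blast
      qed (simp add: set_lebesgue_integral_def)
      finally show ?thesis .
    qed
    have "set_integrable lebesgue (cbox a b) g"
      using g sub by (simp add: locally_integrable_def)
    then have h_int: "integrable lebesgue h"
      using set_integrable_subset[of lebesgue "cbox a b" g "box a b"] box_subset_cbox[of a b]
      by (simp add: set_integrable_def h_def[abs_def])
    have "integral\<^sup>L lebesgue h = set_lebesgue_integral lebesgue (box a b) h"
      unfolding set_lebesgue_integral_def
      by (rule Bochner_Integration.integral_cong) (auto simp: h_def indicator_def)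
    then have "AE x in lebesgue. h x = 0"
      using h_int h_restrict by (intro AE_zero_if_box_integrals_zero) auto
    then show ?thesis by eventually_elim (auto simp: h_def indicator_def split: if_splits)
  qed
  obtain \<D> where D: "countable \<D>" "\<D> \<subseteq> Pow \<Omega>" "\<And>X. X \<in> \<D> \<Longrightarrow> \<exists>a b. X = cbox a b" "\<Union>\<D> = \<Omega>"
    using open_countable_Union_open_cbox[OF \<Omega>] by metis
  have "AE x in lebesgue. \<forall>X\<in>\<D>. x \<in> X \<longrightarrow> g x = 0"
  proof (subst AE_ball_countable[OF D(1)], intro ballI)
    fix X assume X: "X \<in> \<D>"
    then obtain a b where ab: "X = cbox a b" using D(3) by blast
    have "AE x in lebesgue. x \<in> box a b \<longrightarrow> g x = 0" using X D(2) ab by (intro local) auto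
    moreover have "AE x in lebesgue. x \<notin> cbox a b - box a b"
      by (rule AE_not_in) (simp add: negligible_iff_null_sets[symmetric] negligible_frontier_interval)
    ultimately show "AE x in lebesgue. x \<in> X \<longrightarrow> g x = 0"
      by eventually_elim (auto simp: ab)
  qed
  then have "AE x in lebesgue. x \<in> \<Omega> \<longrightarrow> g x = 0"
    by eventually_elim (use D(4) in blast)
  then show ?thesis using \<Omega> by (simp add: AE_restrict_space_iff)
qed

section \<open>The boundary datum as a competitor\<close>

lemma locally_integrable_zero: "locally_integrable \<Omega> (\<lambda>x. 0)"
  by (simp add: locally_integrable_def set_integrable_def)

text \<open>The weak derivative is a choice among all representatives; even for the zero function it is only
known to vanish a.e., by the fundamental lemma.\<close>
lemma wpartial_zero_AE:
  assumes "open \<Omega>"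
  shows "AE x in lebesgue_on \<Omega>. wpartial \<Omega> i (\<lambda>x. 0) x = 0"
proof -
  have "has_weak_partial \<Omega> i (\<lambda>x. 0) (\<lambda>x. 0)"
    by (simp add: has_weak_partial_def locally_integrable_zero)
  then have "has_weak_partial \<Omega> i (\<lambda>x. 0) (wpartial \<Omega> i (\<lambda>x. 0))"
    unfolding wpartial_def by (rule someI[of "has_weak_partial \<Omega> i (\<lambda>x. 0)"])
  then show ?thesis
    by (intro fundamental_lemma_of_variations assms) (auto simp: has_weak_partial_def)
qed

lemma zero_in_W11_0:
  assumes \<Omega>: "open \<Omega>"
  shows "(\<lambda>x. 0) \<in> W11_0 \<Omega>"
proof -
  have "wpartial \<Omega> i (\<lambda>x. 0) \<in> borel_measurable (lebesgue_on \<Omega>)" for i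
  proof -
    \<comment> \<open>The representative is measurable since Lebesgue measure is complete and it vanishes a.e.\<close>
    have "AE x in lebesgue. 0 = indicator \<Omega> x *\<^sub>R wpartial \<Omega> i (\<lambda>x. 0) x"
      using wpartial_zero_AE[OF \<Omega>, of i] \<Omega>
      by (auto simp: AE_restrict_space_iff indicator_def elim!: eventually_mono)
    then have "(\<lambda>x. indicator \<Omega> x *\<^sub>R wpartial \<Omega> i (\<lambda>x. 0) x) \<in> borel_measurable lebesgue"
      by (rule borel_measurable_AE[rotated]) simp
    then show ?thesis using \<Omega> by (simp add: borel_measurable_restrict_space_iff)
  qed
  note m [measurable] = this
  have int: "integrable (lebesgue_on \<Omega>) (wpartial \<Omega> i (\<lambda>x. 0))" for i
    by (subst integrable_cong_AE[of _ _ "\<lambda>x. 0"]) (use wpartial_zero_AE[OF \<Omega>] in auto)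
  have int0: "(LINT x|lebesgue_on \<Omega>. \<bar>0 - wpartial \<Omega> i (\<lambda>x. 0) x\<bar>) = 0" for i
    by (subst integral_cong_AE[of _ _ "\<lambda>x. 0"])
      (use wpartial_zero_AE[OF \<Omega>, of i] in \<open>auto elim!: eventually_mono\<close>)
  have p0: "partial i (\<lambda>x. 0) = (\<lambda>x. 0)" for i
    by (rule ext) (rule partial_eqI[of _ "\<lambda>x. 0"], simp)
  have "(\<lambda>x. 0) \<in> W11_loc \<Omega>"
    unfolding W11_loc_def using locally_integrable_zero
    by (auto simp: has_weak_partial_def intro!: exI[of _ "\<lambda>x. 0"])
  then have "(\<lambda>x. 0) \<in> W11 \<Omega>" using int by (simp add: W11_def)
  moreover have "(\<lambda>x. 0) \<in> test_functions \<Omega>"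
    using Ck_zero by (auto simp: test_functions_def supported_in_def)
  moreover have "L1_tendsto \<Omega> (\<lambda>n x. 0) (\<lambda>x. 0)" by (simp add: L1_tendsto_def)
  moreover have "L1_tendsto \<Omega> (\<lambda>n. partial i (\<lambda>x. 0)) (wpartial \<Omega> i (\<lambda>x. 0))" for i
    unfolding p0 L1_tendsto_def using int int0 by simp
  ultimately show ?thesis
    unfolding W11_0_def by (auto intro!: exI[of _ "\<lambda>n x. 0"])
qed

lemma Linf_integrable:
  assumes "finite_measure (lebesgue_on \<Omega>)" "v \<in> Linf \<Omega>"
  shows "integrable (lebesgue_on \<Omega>) v"
proof -
  interpret finite_measure "lebesgue_on \<Omega>" by fact
  obtain C where "AE x in lebesgue_on \<Omega>. norm (v x) \<le> C" "v \<in> borel_measurable (lebesgue_on \<Omega>)"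
    using assms(2) by (auto simp: Linf_def)
  then show ?thesis by (rule integrable_const_bound)
qed

text \<open>The class of competitors is not empty, which keeps the dual functional from being identically
infinite.\<close>
lemma W1inf_in_C_Sob:
  assumes \<Omega>: "open \<Omega>" and fin: "finite_measure (lebesgue_on \<Omega>)" and u0: "u0 \<in> W1inf \<Omega>"
    and A: "N_function_C1 A A'"
  shows "u0 \<in> C_Sob \<Omega> A u0"
proof -
  interpret finite_measure "lebesgue_on \<Omega>" by (rule fin)
  have "u0 \<in> W11 \<Omega>"
    using u0 by (auto simp: W1inf_def W11_def intro: Linf_integrable[OF fin])
  then have bdry: "u0 \<in> W11_bdry \<Omega> u0"
    using zero_in_W11_0[OF \<Omega>] by (simp add: W11_bdry_def)
  have lin: "wpartial \<Omega> 2 u0 \<in> Linf \<Omega>" using u0 by (simp add: W1inf_def)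
  then obtain C where meas: "wpartial \<Omega> 2 u0 \<in> borel_measurable (lebesgue_on \<Omega>)"
    and C: "AE x in lebesgue_on \<Omega>. \<bar>wpartial \<Omega> 2 u0 x\<bar> \<le> C"
    by (auto simp: Linf_def)
  have mono: "A s \<le> A t" if "0 \<le> s" "s \<le> t" for s t
    using A that strict_mono_on_leD[of "{0..}" A s t] by (auto simp: N_function_C1_def)
  have "(\<integral>\<^sup>+x. ennreal (A (1 * \<bar>wpartial \<Omega> 2 u0 x\<bar>)) \<partial>lebesgue_on \<Omega>)
      \<le> (\<integral>\<^sup>+x. ennreal (A C) \<partial>lebesgue_on \<Omega>)"
    by (rule nn_integral_mono_AE) (use C in \<open>auto elim!: eventually_mono intro!: ennreal_leI mono\<close>)
  also have "\<dots> < \<infinity>" by (simp add: ennreal_mult_eq_top_iff less_top[symmetric])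
  finally have "wpartial \<Omega> 2 u0 \<in> Orlicz A \<Omega>"
    using meas unfolding Orlicz_def by (auto intro!: exI[of _ 1])
  then show ?thesis using bdry by (simp add: C_Sob_def)
qed

section \<open>Extended integrals of conjugates\<close>

lemma eintegral_conj:
  assumes "AE x in M. s x \<in> conj_dom g" and "integrable M (\<lambda>x. conj_val g (s x))"
    and [measurable]: "s \<in> borel_measurable M"
  shows "eintegral M (\<lambda>x. conj_R g (s x)) = ereal (LINT x|M. conj_val g (s x))"
proof -
  have pos: "(\<integral>\<^sup>+x. e2ennreal (conj_R g (s x)) \<partial>M) = (\<integral>\<^sup>+x. ennreal (conj_val g (s x)) \<partial>M)"
  proof (rule nn_integral_cong_AE)
    show "AE x in M. e2ennreal (conj_R g (s x)) = ennreal (conj_val g (s x))"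
      using assms(1) by eventually_elim (simp add: conj_R_eq)
  qed
  have neg: "(\<integral>\<^sup>+x. e2ennreal (- conj_R g (s x)) \<partial>M) = (\<integral>\<^sup>+x. ennreal (- conj_val g (s x)) \<partial>M)"
  proof (rule nn_integral_cong_AE)
    show "AE x in M. e2ennreal (- conj_R g (s x)) = ennreal (- conj_val g (s x))"
      using assms(1) by eventually_elim (simp add: conj_R_eq)
  qed
  obtain r q where "r \<ge> 0" "q \<ge> 0"
    and rq: "(\<integral>\<^sup>+x. ennreal (conj_val g (s x)) \<partial>M) = ennreal r"
    "(\<integral>\<^sup>+x. ennreal (- conj_val g (s x)) \<partial>M) = ennreal q"
    and "(LINT x|M. conj_val g (s x)) = r - q"
    using assms(2) by (elim integrableE)
  then show ?thesis
    unfolding eintegral_def pos neg rq by (simp add: enn2ereal_ennreal)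
qed

text \<open>The conjugate is bounded below, so on a finite measure space its extended integral is never the
undetermined difference of two infinite values.\<close>
lemma conj_neg_part_finite:
  assumes "finite_measure M"
  shows "(\<integral>\<^sup>+x. e2ennreal (- conj_R g (s x)) \<partial>M) < \<infinity>"
proof -
  interpret finite_measure M by fact
  have const_fin: "(\<integral>\<^sup>+x. ennreal \<bar>g 0\<bar> \<partial>M) < \<infinity>"
    by (simp add: ennreal_mult_eq_top_iff less_top[symmetric])
  have "(\<integral>\<^sup>+x. e2ennreal (- conj_R g (s x)) \<partial>M) \<le> (\<integral>\<^sup>+x. ennreal \<bar>g 0\<bar> \<partial>M)"
  proof (rule nn_integral_mono)
    fix x
    have "- conj_R g (s x) \<le> ereal \<bar>g 0\<bar>"
      using conj_R_upper[of "s x" 0 g] by (cases "conj_R g (s x)") auto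
    then show "e2ennreal (- conj_R g (s x)) \<le> ennreal \<bar>g 0\<bar>"
      using e2ennreal_mono by fastforce
  qed
  then show ?thesis
    using const_fin by (rule le_less_trans)
qed

lemma eintegral_conj_not_MInf:
  assumes "finite_measure M"
  shows "eintegral M (\<lambda>x. conj_R g (s x)) \<noteq> -\<infinity>"
proof -
  obtain q where q: "(\<integral>\<^sup>+x. e2ennreal (- conj_R g (s x)) \<partial>M) = ennreal q" "q \<ge> 0"
    using conj_neg_part_finite[OF assms, of g s]
    by (cases "\<integral>\<^sup>+x. e2ennreal (- conj_R g (s x)) \<partial>M") auto
  show ?thesis
    unfolding eintegral_def q(1)
    by (cases "\<integral>\<^sup>+x. e2ennreal (conj_R g (s x)) \<partial>M") (auto simp: enn2ereal_ennreal q(2))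
qed

lemma eintegral_conj_finite:
  assumes "finite_measure M" and [measurable]: "s \<in> borel_measurable M"
    and fin: "eintegral M (\<lambda>x. conj_R g (s x)) \<noteq> \<infinity>"
  shows "AE x in M. s x \<in> conj_dom g" "integrable M (\<lambda>x. conj_val g (s x))"
proof -
  interpret finite_measure M by fact
  have const_fin: "(\<integral>\<^sup>+x. ennreal \<bar>g 0\<bar> \<partial>M) < \<infinity>"
    by (simp add: ennreal_mult_eq_top_iff less_top[symmetric])
  obtain q where q: "(\<integral>\<^sup>+x. e2ennreal (- conj_R g (s x)) \<partial>M) = ennreal q" "q \<ge> 0"
    using conj_neg_part_finite[OF assms(1), of g s]
    by (cases "\<integral>\<^sup>+x. e2ennreal (- conj_R g (s x)) \<partial>M") auto
  have pos: "(\<integral>\<^sup>+x. e2ennreal (conj_R g (s x)) \<partial>M) < \<infinity>"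
    using fin unfolding eintegral_def q(1)
    by (cases "\<integral>\<^sup>+x. e2ennreal (conj_R g (s x)) \<partial>M") (auto simp: enn2ereal_ennreal q(2))
  have [measurable]: "(\<lambda>x. conj_R g (s x)) \<in> borel_measurable M" by measurable
  have "AE x in M. e2ennreal (conj_R g (s x)) \<noteq> \<infinity>"
    by (rule nn_integral_PInf_AE) (use pos in auto)
  then show dom: "AE x in M. s x \<in> conj_dom g"
    by eventually_elim (auto simp: conj_dom_def)
  have "integrable M (\<lambda>x. conj_val g (s x) + \<bar>g 0\<bar>)"
  proof (rule integrableI_nonneg)
    show "AE x in M. 0 \<le> conj_val g (s x) + \<bar>g 0\<bar>"
      using dom
    proof eventually_elim
      case (elim x)
      then show ?case using conj_val_ge_0[OF elim] by simp
    qed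
    have "(\<integral>\<^sup>+x. ennreal (conj_val g (s x) + \<bar>g 0\<bar>) \<partial>M)
        \<le> (\<integral>\<^sup>+x. e2ennreal (conj_R g (s x)) + ennreal \<bar>g 0\<bar> \<partial>M)"
    proof (rule nn_integral_mono_AE)
      show "AE x in M. ennreal (conj_val g (s x) + \<bar>g 0\<bar>) \<le> e2ennreal (conj_R g (s x)) + ennreal \<bar>g 0\<bar>"
        using dom by eventually_elim (auto simp: conj_R_eq ennreal_plus_if intro!: ennreal_leI)
    qed
    also have "\<dots> = (\<integral>\<^sup>+x. e2ennreal (conj_R g (s x)) \<partial>M) + (\<integral>\<^sup>+x. ennreal \<bar>g 0\<bar> \<partial>M)"
      by (rule nn_integral_add) auto
    also have "\<dots> < \<infinity>" using pos const_fin by simp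
    finally show "(\<integral>\<^sup>+x. ennreal (conj_val g (s x) + \<bar>g 0\<bar>) \<partial>M) < \<infinity>" .
  qed measurable
  then have "integrable M (\<lambda>x. (conj_val g (s x) + \<bar>g 0\<bar>) - \<bar>g 0\<bar>)"
    by (intro Bochner_Integration.integrable_diff) auto
  then show "integrable M (\<lambda>x. conj_val g (s x))" by simp
qed

section \<open>The variational problem and its dual\<close>

definition split_integrand :: "(real \<Rightarrow> real) \<Rightarrow> (real \<Rightarrow> real) \<Rightarrow> 2 \<Rightarrow> real \<Rightarrow> real" where
  "split_integrand f1 f2 i = (if i = 1 then f1 else f2)"

lemma split_integrand_simps [simp]:
  "split_integrand f1 f2 1 = f1" "split_integrand f1 f2 2 = f2"
  by (simp_all add: split_integrand_def)

text \<open>Membership in the Orlicz space only provides one multiple \<open>r\<close> with finite modular. The two-sided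
power growth compares the values at \<open>c t\<close> and at \<open>r t\<close> for arbitrary \<open>c\<close>.\<close>
lemma C_Sob_finite_modular:
  assumes fin: "finite_measure (lebesgue_on \<Omega>)" and w: "w \<in> C_Sob \<Omega> A u0"
    and f1: "continuous_on UNIV f1" "\<And>t. \<bar>f1 t\<bar> \<le> a * \<bar>t\<bar> + b" and a: "a \<ge> 0"
    and f2: "continuous_on UNIV f2" "\<And>t. b1 * \<bar>t\<bar> powr p - b2 \<le> f2 t" "\<And>t. f2 t \<le> b3 * \<bar>t\<bar> powr p + b4"
      "\<And>t. f2 t \<ge> 0"
    and b1: "b1 > 0" and b3: "b3 \<ge> 0" and A: "\<And>t. f2 t = A \<bar>t\<bar>"
  shows "finite_modular (lebesgue_on \<Omega>) (split_integrand f1 f2) (wgrad \<Omega> w)"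
proof -
  let ?M = "lebesgue_on \<Omega>"
  interpret finite_measure ?M by (rule fin)
  have [measurable]: "f1 \<in> borel_measurable borel" "f2 \<in> borel_measurable borel"
    using f1(1) f2(1) by (auto intro: borel_measurable_continuous_onI)
  have int: "integrable ?M (wpartial \<Omega> i w)" for i
    using w by (simp add: C_Sob_def W11_bdry_def W11_def)
  then have [measurable]: "wpartial \<Omega> i w \<in> borel_measurable ?M" for i by auto
  obtain r where r: "r > 0" and rfin: "(\<integral>\<^sup>+x. ennreal (A (r * \<bar>wpartial \<Omega> 2 w x\<bar>)) \<partial>?M) < \<infinity>"
    using w by (auto simp: C_Sob_def Orlicz_def)
  have eqA: "A (r * \<bar>t\<bar>) = f2 (r * t)" for t using r by (simp add: A abs_mult)
  have intA: "integrable ?M (\<lambda>x. f2 (r * wpartial \<Omega> 2 w x))"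
  proof (rule integrableI_nonneg)
    show "(\<integral>\<^sup>+x. ennreal (f2 (r * wpartial \<Omega> 2 w x)) \<partial>?M) < \<infinity>"
      using rfin unfolding eqA .
  qed (use f2(4) in auto)
  have i1: "integrable ?M (\<lambda>x. f1 (c * wpartial \<Omega> 1 w x))" for c
  proof (rule Bochner_Integration.integrable_bound)
    show "integrable ?M (\<lambda>x. a * \<bar>c * wpartial \<Omega> 1 w x\<bar> + b)" using int[of 1] by auto
    show "AE x in ?M. norm (f1 (c * wpartial \<Omega> 1 w x)) \<le> norm (a * \<bar>c * wpartial \<Omega> 1 w x\<bar> + b)"
      using f1(2) by (intro always_eventually allI) (metis abs_ge_self order_trans real_norm_def)
  qed measurable
  have i2: "integrable ?M (\<lambda>x. f2 (c * wpartial \<Omega> 2 w x))" for c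
  proof (rule Bochner_Integration.integrable_bound)
    define k where "k = b3 * (\<bar>c\<bar> / r) powr p / b1"
    have k: "k \<ge> 0" using b1 b3 by (simp add: k_def)
    show "integrable ?M (\<lambda>x. k * (f2 (r * wpartial \<Omega> 2 w x) + b2) + b4)" using intA by auto
    have "f2 (c * t) \<le> k * (f2 (r * t) + b2) + b4" for t
    proof -
      have "\<bar>c * t\<bar> = (\<bar>c\<bar> / r) * \<bar>r * t\<bar>" using r by (simp add: abs_mult)
      also have "\<dots> powr p = (\<bar>c\<bar> / r) powr p * \<bar>r * t\<bar> powr p"
        by (rule powr_mult)
      finally have "\<bar>c * t\<bar> powr p = (\<bar>c\<bar> / r) powr p * \<bar>r * t\<bar> powr p" .
      then have "b3 * \<bar>c * t\<bar> powr p = k * (b1 * \<bar>r * t\<bar> powr p)" using b1 by (simp add: k_def)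
      also have "\<dots> \<le> k * (f2 (r * t) + b2)"
        using f2(2)[of "r * t"] k by (intro mult_left_mono) auto
      finally show ?thesis using f2(3)[of "c * t"] by linarith
    qed
    then show "AE x in ?M. norm (f2 (c * wpartial \<Omega> 2 w x))
        \<le> norm (k * (f2 (r * wpartial \<Omega> 2 w x) + b2) + b4)"
      using f2(4) by (intro always_eventually allI) (metis abs_ge_self abs_of_nonneg order_trans real_norm_def)
  qed measurable
  show ?thesis
    unfolding finite_modular_def forall_2 wgrad_def using i1 i2 by simp
qed

lemma lagrangian_eq_sep_lagrangian:
  assumes A: "N_function_C1 A A'" and g: "\<And>t. f2 t = A \<bar>t\<bar>"
    and \<tau>: "dual_admissible (lebesgue_on \<Omega>) (split_integrand f1 f2) \<tau>"
  shows "lagrangian \<Omega> A f1 w \<tau> = ereal (sep_lagrangian (lebesgue_on \<Omega>) (split_integrand f1 f2) (wgrad \<Omega> w) \<tau>)"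
proof -
  note D = dual_admissibleD[OF \<tau>]
  have 1: "eintegral (lebesgue_on \<Omega>) (\<lambda>x. conj_R f1 (\<tau> x $ 1)) = ereal (LINT x|lebesgue_on \<Omega>. conj_val f1 (\<tau> x $ 1))"
    using D(1)[of 1] D(2)[of 1] D(3)[of 1] by (intro eintegral_conj) auto
  have "ereal (conj_N A \<bar>\<tau> x $ 2\<bar>) = conj_R f2 (\<tau> x $ 2)" for x
    using N_function_conj_dom[OF A g] by (simp add: conj_N_eq_conj_val[OF A g] conj_R_eq)
  then have 2: "eintegral (lebesgue_on \<Omega>) (\<lambda>x. ereal (conj_N A \<bar>\<tau> x $ 2\<bar>))
      = ereal (LINT x|lebesgue_on \<Omega>. conj_val f2 (\<tau> x $ 2))"
    using eintegral_conj[of "\<lambda>x. \<tau> x $ 2" f2 "lebesgue_on \<Omega>"] D(1)[of 2] D(2)[of 2] D(3)[of 2] by simp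
  show ?thesis
    unfolding lagrangian_def 1 2 sep_lagrangian_def conj_energy_def sum_2 by simp
qed

text \<open>Both conjugate integrals are bounded below, so neither can be infinite when the Lagrangian exceeds
minus infinity. Fields that violate this cannot compete in the maximization, which reduces the dual
problem to fields of finite conjugate energy.\<close>
lemma lagrangian_finite_imp_admissible:
  assumes fin: "finite_measure (lebesgue_on \<Omega>)"
    and A: "N_function_C1 A A'" and g: "\<And>t. f2 t = A \<bar>t\<bar>"
    and \<tau>: "\<tau> \<in> L_inf_Astar \<Omega> A" and l: "lagrangian \<Omega> A f1 w \<tau> \<noteq> -\<infinity>"
  shows "dual_admissible (lebesgue_on \<Omega>) (split_integrand f1 f2) \<tau>"
proof -
  have m [measurable]: "(\<lambda>x. \<tau> x $ 1) \<in> borel_measurable (lebesgue_on \<Omega>)"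
    "(\<lambda>x. \<tau> x $ 2) \<in> borel_measurable (lebesgue_on \<Omega>)"
    using \<tau> by (auto simp: L_inf_Astar_def Linf_def Orlicz_def)
  have eq: "ereal (conj_N A \<bar>\<tau> x $ 2\<bar>) = conj_R f2 (\<tau> x $ 2)" for x
    using N_function_conj_dom[OF A g] by (simp add: conj_N_eq_conj_val[OF A g] conj_R_eq)
  have "eintegral (lebesgue_on \<Omega>) (\<lambda>x. conj_R f1 (\<tau> x $ 1)) \<noteq> \<infinity>"
    using l eintegral_conj_not_MInf[OF fin, of f2 "\<lambda>x. \<tau> x $ 2"] unfolding lagrangian_def eq
    by (cases "eintegral (lebesgue_on \<Omega>) (\<lambda>x. conj_R f2 (\<tau> x $ 2))") auto
  note 1 = eintegral_conj_finite[OF fin m(1) this]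
  have "eintegral (lebesgue_on \<Omega>) (\<lambda>x. conj_R f2 (\<tau> x $ 2)) \<noteq> \<infinity>"
    using l eintegral_conj[OF 1 m(1)] unfolding lagrangian_def eq by auto
  note 2 = eintegral_conj_finite[OF fin m(2) this]
  show ?thesis
    unfolding dual_admissible_def forall_2 using m 1 2 by simp
qed

lemma admissible_imp_L_inf_Astar:
  assumes A: "N_function_C1 A A'" and g: "\<And>t. f2 t = A \<bar>t\<bar>"
    and growth: "\<And>t. f1 t \<le> a * \<bar>t\<bar> + b"
    and \<tau>: "dual_admissible (lebesgue_on \<Omega>) (split_integrand f1 f2) \<tau>"
  shows "\<tau> \<in> L_inf_Astar \<Omega> A"
proof -
  note D = dual_admissibleD[OF \<tau>]
  have "AE x in lebesgue_on \<Omega>. \<tau> x $ 1 \<in> conj_dom f1" using D(2)[of 1] by simp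
  then have "AE x in lebesgue_on \<Omega>. \<bar>\<tau> x $ 1\<bar> \<le> a"
    by eventually_elim (rule conj_dom_linear_growth[OF growth])
  then have 1: "(\<lambda>x. \<tau> x $ 1) \<in> Linf \<Omega>" using D(1)[of 1] by (auto simp: Linf_def)
  have "integrable (lebesgue_on \<Omega>) (\<lambda>x. conj_val f2 (\<tau> x $ 2))" using D(3)[of 2] by simp
  then have "(\<integral>\<^sup>+x. ennreal (norm (conj_val f2 (\<tau> x $ 2))) \<partial>lebesgue_on \<Omega>) < \<infinity>"
    by (simp add: integrable_iff_bounded)
  moreover have "(\<integral>\<^sup>+x. ennreal (conj_N A (1 * \<bar>\<tau> x $ 2\<bar>)) \<partial>lebesgue_on \<Omega>)
      \<le> (\<integral>\<^sup>+x. ennreal (norm (conj_val f2 (\<tau> x $ 2))) \<partial>lebesgue_on \<Omega>)"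
    by (intro nn_integral_mono ennreal_leI) (simp add: conj_N_eq_conj_val[OF A g])
  ultimately have "(\<integral>\<^sup>+x. ennreal (conj_N A (1 * \<bar>\<tau> x $ 2\<bar>)) \<partial>lebesgue_on \<Omega>) < \<infinity>"
    by (rule le_less_trans[rotated])
  then have "(\<lambda>x. \<tau> x $ 2) \<in> Orlicz (conj_N A) \<Omega>"
    using D(1)[of 2] unfolding Orlicz_def by (auto intro!: exI[of _ 1])
  then show ?thesis using 1 by (simp add: L_inf_Astar_def)
qed

theorem theorem5p1:
  fixes \<Omega> :: "(real^2) set" and u0 ustar :: "real^2 \<Rightarrow> real"
    and A A' f1 f2 :: "real \<Rightarrow> real" and f :: "real^2 \<Rightarrow> real"
    and u :: "real \<Rightarrow> real^2 \<Rightarrow> real"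
    and p \<mu> \<gamma> \<kappa> c c3 a1 a2 a3 a4 b1 b2 b3 b4 c1 c1' c2 c2' :: real
  assumes "bounded \<Omega>" and "lipschitz_domain \<Omega>" and "normal_domain_x2 \<Omega>"
    and "u0 \<in> W1inf \<Omega>"
    and "N_function_C1 A A'"
    and "\<And>t. t \<ge> 0 \<Longrightarrow> conj_N A (A' t) \<le> c * (A t + 1)"
    and "c3 > 0" and "\<And>s t. A \<bar>s + t\<bar> \<le> c3 * (A \<bar>s\<bar> + A \<bar>t\<bar>)"
    and "p > 1" and "\<mu> > 1" and "\<gamma> \<ge> 0"
    and "a2 \<ge> 0" and "a4 \<ge> 0" and "b2 \<ge> 0" and "b4 \<ge> 0"
    and "a1 > 0" and "a3 > 0" and "b1 > 0" and "b3 > 0"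
    and "c1 > 0" and "c1' > 0" and "c2 > 0" and "c2' > 0"
    and "\<And>\<xi>. f \<xi> = f1 (\<xi>$1) + f2 (\<xi>$2)"
    and "convex_on UNIV f1" and "convex_on UNIV f2" and "C2_real f1" and "C2_real f2"
    and "\<And>t. f2 t = A \<bar>t\<bar>"
    and "\<And>t. a1 * \<bar>t\<bar> - a2 \<le> f1 t \<and> f1 t \<le> a3 * \<bar>t\<bar> + a4"
    and "\<And>t. c1 * (1 + \<bar>t\<bar>) powr (- \<mu>) \<le> deriv (deriv f1) t
           \<and> deriv (deriv f1) t \<le> c1' * (1 + \<bar>t\<bar>) powr \<gamma>"
    and "\<And>t. b1 * \<bar>t\<bar> powr p - b2 \<le> f2 t \<and> f2 t \<le> b3 * \<bar>t\<bar> powr p + b4"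
    and "\<And>t. c2 * (1 + \<bar>t\<bar>) powr (p - 2) \<le> deriv (deriv f2) t
           \<and> deriv (deriv f2) t \<le> c2' * (1 + \<bar>t\<bar>) powr (p - 2)"
    and "ustar \<in> gen_minimizers \<Omega> A u0 f"
    and "\<And>\<delta>. \<delta> \<in> {0<..<1} \<Longrightarrow> u \<delta> \<in> W11_bdry \<Omega> u0"
    and "\<exists>d. (\<forall>n. d n \<in> {0<..<1}) \<and> d \<longlonglongrightarrow> 0 \<and> L1_tendsto \<Omega> (\<lambda>n. u (d n)) ustar"
    and "W11_loc_uniformly \<Omega> {0<..<1}
           (\<lambda>\<delta> x. (1 + \<bar>wpartial \<Omega> 1 (u \<delta>) x\<bar>\<^sup>2) powr (\<kappa> / 2)
                + (1 + \<bar>wpartial \<Omega> 2 (u \<delta>) x\<bar>\<^sup>2) powr (\<kappa> / 2))"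
  shows "\<exists>\<tau>. dual_solution \<Omega> A f1 u0 \<tau> \<and>
           (\<forall>\<sigma>. dual_solution \<Omega> A f1 u0 \<sigma> \<longrightarrow> (AE x in lebesgue_on \<Omega>. \<sigma> x = \<tau> x))"
proof -
  let ?M = "lebesgue_on \<Omega>" and ?F = "split_integrand f1 f2"
  have \<Omega>: "open \<Omega>" using assms(2) by (simp add: lipschitz_domain_def)
  have "\<Omega> \<in> lmeasurable" by (rule lmeasurable_open[OF assms(1) \<Omega>])
  then have fin: "finite_measure ?M" by (rule finite_measure_lebesgue_on)
  note N = \<open>N_function_C1 A A'\<close> and f2_eq = \<open>\<And>t. f2 t = A \<bar>t\<bar>\<close>
  have D1: "(f1 has_real_derivative deriv f1 t) (at t)" and D2: "(f2 has_real_derivative deriv f2 t) (at t)" for t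
    using \<open>C2_real f1\<close> \<open>C2_real f2\<close>
    by (auto simp: C2_real_def DERIV_deriv_iff_real_differentiable)
  have C1: "continuous_on UNIV (deriv f1)" "continuous_on UNIV (deriv f2)"
    using \<open>C2_real f1\<close> \<open>C2_real f2\<close>
    by (auto simp: C2_real_def intro!: continuous_at_imp_continuous_on differentiable_imp_continuous_within)
  have C0: "continuous_on UNIV f1" "continuous_on UNIV f2"
    using D1 D2 by (auto intro!: continuous_at_imp_continuous_on DERIV_isCont)
  have f2_0: "f2 t \<ge> 0" for t using N f2_eq by (simp add: N_function_C1_def)
  interpret finite_measure ?M by (rule fin)
  interpret separable_dual ?M ?F "split_integrand (deriv f1) (deriv f2)"
  proof
    show "(?F i has_real_derivative split_integrand (deriv f1) (deriv f2) i t) (at t)" for i t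
      using D1 D2 by (simp add: split_integrand_def)
    show "continuous_on UNIV (split_integrand (deriv f1) (deriv f2) i)" for i
      using C1 by (simp add: split_integrand_def)
    have "- a2 \<le> f1 t" for t
      using \<open>\<And>t. a1 * \<bar>t\<bar> - a2 \<le> f1 t \<and> f1 t \<le> a3 * \<bar>t\<bar> + a4\<close>[of t] \<open>a1 > 0\<close>
        mult_nonneg_nonneg[of a1 "\<bar>t\<bar>"] by linarith
    then show "\<exists>B. \<forall>t. B \<le> ?F i t" for i
      using f2_0 by (auto simp: split_integrand_def)
  qed
  define V where "V = wgrad \<Omega> ` C_Sob \<Omega> A u0"
  have u0: "u0 \<in> C_Sob \<Omega> A u0"
    by (rule W1inf_in_C_Sob[OF \<Omega> fin \<open>u0 \<in> W1inf \<Omega>\<close> N])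
  have f1_abs: "\<bar>f1 t\<bar> \<le> a3 * \<bar>t\<bar> + (a2 + a4)" for t
  proof -
    have "0 \<le> a1 * \<bar>t\<bar>" "0 \<le> a3 * \<bar>t\<bar>" using \<open>a1 > 0\<close> \<open>a3 > 0\<close> by simp_all
    then show ?thesis
      using \<open>\<And>t. a1 * \<bar>t\<bar> - a2 \<le> f1 t \<and> f1 t \<le> a3 * \<bar>t\<bar> + a4\<close>[of t] \<open>a2 \<ge> 0\<close> \<open>a4 \<ge> 0\<close>
      by linarith
  qed
  have growth2: "b1 * \<bar>t\<bar> powr p - b2 \<le> f2 t" "f2 t \<le> b3 * \<bar>t\<bar> powr p + b4" for t
    using \<open>\<And>t. b1 * \<bar>t\<bar> powr p - b2 \<le> f2 t \<and> f2 t \<le> b3 * \<bar>t\<bar> powr p + b4\<close> by auto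
  have V_ne: "V \<noteq> {}" using u0 by (auto simp: V_def)
  have V_mod: "finite_modular ?M ?F v" if v: "v \<in> V" for v
  proof -
    from v obtain w where w: "w \<in> C_Sob \<Omega> A u0" "v = wgrad \<Omega> w" by (auto simp: V_def)
    show ?thesis
      unfolding w(2)
      by (rule C_Sob_finite_modular[OF fin w(1) C0(1) f1_abs _ C0(2) _ _ f2_0, where ?b1.0 = b1 and p = p
            and ?b2.0 = b2 and ?b3.0 = b3 and ?b4.0 = b4])
        (use assms in auto)
  qed
  have "\<exists>\<tau> m. adm \<tau> \<and> (\<forall>v\<in>V. m \<le> L v \<tau>) \<and>
      (\<forall>\<sigma> m'. adm \<sigma> \<longrightarrow> (\<forall>v\<in>V. m' \<le> L v \<sigma>) \<longrightarrow> m' \<le> m) \<and>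
      (\<forall>\<sigma>. adm \<sigma> \<longrightarrow> (\<forall>v\<in>V. m \<le> L v \<sigma>) \<longrightarrow> (AE x in ?M. \<sigma> x = \<tau> x))"
    using V_ne V_mod by (rule dual_problem_uniquely_solvable)
  then obtain \<tau> m where \<tau>: "adm \<tau>" and \<tau>_low: "\<forall>v\<in>V. m \<le> L v \<tau>"
    and max: "\<And>\<sigma> m'. adm \<sigma> \<Longrightarrow> \<forall>v\<in>V. m' \<le> L v \<sigma> \<Longrightarrow> m' \<le> m"
    and unique: "\<And>\<sigma>. adm \<sigma> \<Longrightarrow> \<forall>v\<in>V. m \<le> L v \<sigma> \<Longrightarrow> AE x in ?M. \<sigma> x = \<tau> x"
    by blast
  have lag: "lagrangian \<Omega> A f1 w \<sigma> = ereal (L (wgrad \<Omega> w) \<sigma>)" if "adm \<sigma>" for w \<sigma>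
    by (rule lagrangian_eq_sep_lagrangian[OF N f2_eq that])
  have low_iff: "ereal r \<le> R_fun \<Omega> A f1 u0 \<sigma> \<longleftrightarrow> (\<forall>v\<in>V. r \<le> L v \<sigma>)" if "adm \<sigma>" for r \<sigma>
    by (simp add: R_fun_def le_INF_iff lag[OF that] V_def)
  have adm: "adm \<sigma>" if "\<sigma> \<in> L_inf_Astar \<Omega> A" "R_fun \<Omega> A f1 u0 \<sigma> \<noteq> -\<infinity>" for \<sigma>
  proof (rule lagrangian_finite_imp_admissible[OF fin N f2_eq that(1)])
    have "R_fun \<Omega> A f1 u0 \<sigma> \<le> lagrangian \<Omega> A f1 u0 \<sigma>"
      unfolding R_fun_def by (rule INF_lower[OF u0])
    then show "lagrangian \<Omega> A f1 u0 \<sigma> \<noteq> -\<infinity>" using that(2) by auto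
  qed
  have R_\<tau>: "ereal m \<le> R_fun \<Omega> A f1 u0 \<tau>" using low_iff[OF \<tau>] \<tau>_low by simp
  have R_le: "R_fun \<Omega> A f1 u0 \<sigma> \<le> ereal m" if \<sigma>: "\<sigma> \<in> L_inf_Astar \<Omega> A" for \<sigma>
  proof (rule ccontr)
    assume "\<not> R_fun \<Omega> A f1 u0 \<sigma> \<le> ereal m"
    then obtain r where r: "ereal m < ereal r" "ereal r < R_fun \<Omega> A f1 u0 \<sigma>"
      using ereal_dense2[of "ereal m" "R_fun \<Omega> A f1 u0 \<sigma>"] by (auto simp: not_le)
    then have "adm \<sigma>" by (intro adm[OF \<sigma>]) auto
    then have "r \<le> m" using max low_iff less_imp_le[OF r(2)] by blast
    with r(1) show False by simp
  qed
  have "\<tau> \<in> L_inf_Astar \<Omega> A"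
    by (rule admissible_imp_L_inf_Astar[OF N f2_eq _ \<tau>, where a = a3 and b = a4]) (use assms in auto)
  then have "dual_solution \<Omega> A f1 u0 \<tau>"
    unfolding dual_solution_def using R_\<tau> R_le order_trans by blast
  moreover have "AE x in ?M. \<sigma> x = \<tau> x" if \<sigma>: "dual_solution \<Omega> A f1 u0 \<sigma>" for \<sigma>
  proof -
    have *: "ereal m \<le> R_fun \<Omega> A f1 u0 \<sigma>" "\<sigma> \<in> L_inf_Astar \<Omega> A"
      using \<sigma> R_\<tau> \<open>\<tau> \<in> L_inf_Astar \<Omega> A\<close> order_trans unfolding dual_solution_def by blast+
    then have "adm \<sigma>" by (intro adm) auto
    then show ?thesis using unique low_iff *(1) by blast
  qed
  ultimately show ?thesis by blast
qed

end
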